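(* Let $V(-x)=V(x)$ for all $x\in\mathbb{R}^d$, let $h\in(0,1)$ and $\psi_{0h}\in S_h$. Then there exists a unique global semidiscrete solution $\psi_h$ of the Hartree initial-boundary value problem with initial condition $\psi_{0h}$, i.e. a unique function $\psi_h:[0,\infty)\to S_h$ whose restriction to $[0,T)$ is a semidiscrete solution on $[0,T)$ with initial condition $\psi_{0h}$ for every $0<T<\infty$.
   Context: Setting: $\Omega\subset\mathbb{R}^d$ is a bounded domain with smooth boundary; $v\in C_0^\infty(\Omega,\mathbb{R})$, $\lambda\in C_0^\infty(\Omega,\mathbb{R})$, $V\in C_0^\infty(\mathbb{R}^d,\mathbb{R})$, where the subscript $0$ denotes compact support. All Lebesgue and Sobolev spaces are spaces of complex-valued functions over $\Omega$; $(\cdot,\cdot)_{L^2}$ is the $L^2$ scalar product, antilinear in the first and linear in the second argument. Define $g_V[\varphi](x):=\int_\Omega V(x-y)\varphi(y)\,dy$ and $f[\psi]:=\lambda\, g_V[|\psi|^2]\,\psi$. Galerkin spaces: $\{S_h\}_{h\in(0,1)}$ is a family of (complex) linear subspaces of $H^1_0$ with $S_h\subset C(\overline\Omega)\cap H_0^1$ and $\dim S_h=N_h<\infty$ for all $h\in(0,1)$. A semidiscrete solution on $[0,T)$ with initial condition $\psi_{0h}\in S_h$ is a function $\psi_h:[0,T)\to S_h$ with $\psi_h,\dot\psi_h\in L^2(0,T;S_h)$ such that $\psi_h(0)=\psi_{0h}$ and $$i\,\tfrac{d}{dt}(\varphi,\psi_h)_{L^2}=(\nabla\varphi,\nabla\psi_h)_{L^2}+(\varphi,v\psi_h)_{L^2}+(\varphi,f[\psi_h])_{L^2}\quad\text{for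 all }\varphi\in S_h,\ t\in[0,T).$$ *)

theory Defs
  imports "HOL-Analysis.Analysis" "HOL-Library.Function_Algebras"
begin

section \<open>Smooth functions and smooth domains\<close>

definition partial_deriv ::
    "'a::euclidean_space \<Rightarrow> ('a \<Rightarrow> 'b::real_normed_vector) \<Rightarrow> 'a \<Rightarrow> 'b" where
  "partial_deriv b f x = frechet_derivative f (at x) b"

primrec C_k :: "nat \<Rightarrow> ('a::euclidean_space \<Rightarrow> 'b::real_normed_vector) \<Rightarrow> bool" where
  "C_k 0 f \<longleftrightarrow> continuous_on UNIV f"
| "C_k (Suc k) f \<longleftrightarrow>
     (\<forall>x. f differentiable (at x)) \<and> (\<forall>b\<in>Basis. C_k k (partial_deriv b f))"

definition smooth :: "('a::euclidean_space \<Rightarrow> 'b::real_normed_vector) \<Rightarrow> bool" where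
  "smooth f \<longleftrightarrow> (\<forall>k. C_k k f)"

text \<open>Elements of \<open>C\<^sub>0\<^sup>\<infinity>(U)\<close> are represented by their extension by zero to the whole space.\<close>

definition C0_infinity ::
    "'a::euclidean_space set \<Rightarrow> ('a \<Rightarrow> 'b::real_normed_vector) set" where
  "C0_infinity U =
     {f. smooth f \<and> compact (closure {x. f x \<noteq> 0}) \<and> closure {x. f x \<noteq> 0} \<subseteq> U}"

text \<open>Near each boundary point, the domain lies on one side of the graph of a smooth function
  \<open>\<gamma>\<close> of the coordinates other than the one in direction \<open>b\<close>; the sign \<open>s\<close> selects the side.\<close>

definition smooth_boundary :: "'a::euclidean_space set \<Rightarrow> bool" where
  "smooth_boundary \<Omega> \<longleftrightarrow>
     (\<forall>x\<in>frontier \<Omega>. \<exists>r>0. \<exists>b\<in>Basis. \<exists>s\<in>{-1, 1}. \<exists>\<gamma> :: 'a \<Rightarrow> real.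
        smooth \<gamma> \<and> (\<forall>y c. \<gamma> (y + c *\<^sub>R b) = \<gamma> y) \<and>
        \<Omega> \<inter> ball x r = {y \<in> ball x r. \<gamma> y < s * (y \<bullet> b)})"

definition bounded_smooth_domain :: "'a::euclidean_space set \<Rightarrow> bool" where
  "bounded_smooth_domain \<Omega> \<longleftrightarrow>
     open \<Omega> \<and> connected \<Omega> \<and> \<Omega> \<noteq> {} \<and> bounded \<Omega> \<and> smooth_boundary \<Omega>"

section \<open>Lebesgue and Sobolev spaces\<close>

text \<open>Elements of Lebesgue and Sobolev spaces are represented by individual functions, of which
  only the restriction to \<open>\<Omega>\<close> matters.\<close>

definition L2_space :: "'a::euclidean_space set \<Rightarrow> ('a \<Rightarrow> complex) set" where
  "L2_space \<Omega> = {u. set_borel_measurable lebesgue \<Omega> u \<and>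
                    set_integrable lebesgue \<Omega> (\<lambda>x. (cmod (u x))\<^sup>2)}"

definition L2_inner ::
    "'a::euclidean_space set \<Rightarrow> ('a \<Rightarrow> complex) \<Rightarrow> ('a \<Rightarrow> complex) \<Rightarrow> complex" where
  "L2_inner \<Omega> u w = set_lebesgue_integral lebesgue \<Omega> (\<lambda>x. cnj (u x) * w x)"

definition L2_norm :: "'a::euclidean_space set \<Rightarrow> ('a \<Rightarrow> complex) \<Rightarrow> real" where
  "L2_norm \<Omega> u = sqrt (set_lebesgue_integral lebesgue \<Omega> (\<lambda>x. (cmod (u x))\<^sup>2))"

definition locally_integrable :: "'a::euclidean_space set \<Rightarrow> ('a \<Rightarrow> complex) \<Rightarrow> bool" where
  "locally_integrable \<Omega> u \<longleftrightarrow> (\<forall>K. compact K \<and> K \<subseteq> \<Omega> \<longrightarrow> set_integrable lebesgue K u)"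

definition is_weak_partial ::
    "'a::euclidean_space set \<Rightarrow> 'a \<Rightarrow> ('a \<Rightarrow> complex) \<Rightarrow> ('a \<Rightarrow> complex) \<Rightarrow> bool" where
  "is_weak_partial \<Omega> b u w \<longleftrightarrow>
     locally_integrable \<Omega> u \<and> locally_integrable \<Omega> w \<and>
     (\<forall>\<eta>\<in>C0_infinity \<Omega>.
        set_lebesgue_integral lebesgue \<Omega> (\<lambda>x. u x * partial_deriv b \<eta> x) =
        - set_lebesgue_integral lebesgue \<Omega> (\<lambda>x. w x * \<eta> x))"

text \<open>Weak derivatives are unique up to null sets, so the integrals below do not depend on the
  choice made here.\<close>

definition weak_partial ::
    "'a::euclidean_space set \<Rightarrow> 'a \<Rightarrow> ('a \<Rightarrow> complex) \<Rightarrow> 'a \<Rightarrow> complex" where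
  "weak_partial \<Omega> b u = (SOME w. is_weak_partial \<Omega> b u w)"

definition grad_inner ::
    "'a::euclidean_space set \<Rightarrow> ('a \<Rightarrow> complex) \<Rightarrow> ('a \<Rightarrow> complex) \<Rightarrow> complex" where
  "grad_inner \<Omega> u w = (\<Sum>b\<in>Basis. L2_inner \<Omega> (weak_partial \<Omega> b u) (weak_partial \<Omega> b w))"

definition H1_space :: "'a::euclidean_space set \<Rightarrow> ('a \<Rightarrow> complex) set" where
  "H1_space \<Omega> = {u \<in> L2_space \<Omega>. \<forall>b\<in>Basis. \<exists>w\<in>L2_space \<Omega>. is_weak_partial \<Omega> b u w}"

definition H1_norm :: "'a::euclidean_space set \<Rightarrow> ('a \<Rightarrow> complex) \<Rightarrow> real" where
  "H1_norm \<Omega> u =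
     sqrt ((L2_norm \<Omega> u)\<^sup>2 + (\<Sum>b\<in>Basis. (L2_norm \<Omega> (weak_partial \<Omega> b u))\<^sup>2))"

definition H10_space :: "'a::euclidean_space set \<Rightarrow> ('a \<Rightarrow> complex) set" where
  "H10_space \<Omega> = {u \<in> H1_space \<Omega>.
     \<exists>\<eta> :: nat \<Rightarrow> 'a \<Rightarrow> complex. (\<forall>n. \<eta> n \<in> C0_infinity \<Omega>) \<and>
        (\<lambda>n. H1_norm \<Omega> (\<lambda>x. \<eta> n x - u x)) \<longlonglongrightarrow> 0}"

text \<open>A function on \<open>closure \<Omega>\<close> is represented by its extension by zero. Hence equality of total
  functions is equality on \<open>closure \<Omega>\<close>, and linear spaces of such functions have their true
  dimension.\<close>

definition C_closure :: "'a::euclidean_space set \<Rightarrow> ('a \<Rightarrow> complex) set" where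
  "C_closure \<Omega> = {u. continuous_on (closure \<Omega>) u \<and> (\<forall>x. x \<notin> closure \<Omega> \<longrightarrow> u x = 0)}"

section \<open>Galerkin spaces\<close>

interpretation cfun: vector_space "\<lambda>(c::complex) (u :: 'a \<Rightarrow> complex) x. c * u x"
  by unfold_locales (auto simp: fun_eq_iff algebra_simps)

text \<open>Since \<open>cfun.dim\<close> is \<open>0\<close> on infinite-dimensional spaces, a finite spanning set is required
  separately.\<close>

definition galerkin_family ::
    "'a::euclidean_space set \<Rightarrow> (real \<Rightarrow> ('a \<Rightarrow> complex) set) \<Rightarrow> (real \<Rightarrow> nat) \<Rightarrow> bool" where
  "galerkin_family \<Omega> S N \<longleftrightarrow>
     (\<forall>h\<in>{0<..<1}.
        cfun.subspace (S h) \<and> S h \<subseteq> C_closure \<Omega> \<inter> H10_space \<Omega> \<and>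
        (\<exists>B. finite B \<and> cfun.span B = S h) \<and> cfun.dim (S h) = N h)"

text \<open>\<open>L\<^sup>2(0,T;S)\<close> for a finite-dimensional \<open>S \<subseteq> C_closure \<Omega>\<close>: strongly measurable (an almost
  everywhere limit of simple functions) with square integrable norm. All norms on \<open>S\<close> are
  equivalent; the \<open>L\<^sup>2\<close> norm is used.\<close>

definition Bochner_L2 ::
    "'a::euclidean_space set \<Rightarrow> real \<Rightarrow> ('a \<Rightarrow> complex) set \<Rightarrow> (real \<Rightarrow> 'a \<Rightarrow> complex) set" where
  "Bochner_L2 \<Omega> T S = {u.
     (AE t in lebesgue_on {0<..<T}. u t \<in> S) \<and>
     (\<exists>s :: nat \<Rightarrow> real \<Rightarrow> 'a \<Rightarrow> complex.
        (\<forall>n. simple_function (lebesgue_on {0<..<T}) (s n) \<and> (\<forall>t\<in>{0<..<T}. s n t \<in> S)) \<and>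
        (AE t in lebesgue_on {0<..<T}. (\<lambda>n. L2_norm \<Omega> (\<lambda>x. s n t x - u t x)) \<longlonglongrightarrow> 0)) \<and>
     set_integrable lebesgue {0<..<T} (\<lambda>t. (L2_norm \<Omega> (u t))\<^sup>2)}"

text \<open>\<open>w\<close> is the weak time derivative of \<open>u\<close> on \<open>(0,T)\<close>. The \<open>S\<close>-valued integrals in its
  definition are expressed through the functionals \<open>(\<phi>, \<sqdot>)\<close> with \<open>\<phi> \<in> S\<close>, which form the whole
  dual of the finite-dimensional Hilbert space \<open>S\<close>.\<close>

definition is_weak_time_deriv ::
    "'a::euclidean_space set \<Rightarrow> real \<Rightarrow> ('a \<Rightarrow> complex) set \<Rightarrow>
     (real \<Rightarrow> 'a \<Rightarrow> complex) \<Rightarrow> (real \<Rightarrow> 'a \<Rightarrow> complex) \<Rightarrow> bool" where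
  "is_weak_time_deriv \<Omega> T S u w \<longleftrightarrow>
     (\<forall>\<phi>\<in>S. is_weak_partial {0<..<T} 1 (\<lambda>t. L2_inner \<Omega> \<phi> (u t)) (\<lambda>t. L2_inner \<Omega> \<phi> (w t)))"

section \<open>The semidiscrete Hartree equation\<close>

definition g_conv ::
    "'a::euclidean_space set \<Rightarrow> ('a \<Rightarrow> real) \<Rightarrow> ('a \<Rightarrow> complex) \<Rightarrow> 'a \<Rightarrow> complex" where
  "g_conv \<Omega> V \<phi> x =
     set_lebesgue_integral lebesgue \<Omega> (\<lambda>y. complex_of_real (V (x - y)) * \<phi> y)"

definition f_nonlin ::
    "'a::euclidean_space set \<Rightarrow> ('a \<Rightarrow> real) \<Rightarrow> ('a \<Rightarrow> real) \<Rightarrow> ('a \<Rightarrow> complex) \<Rightarrow> 'a \<Rightarrow> complex" where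
  "f_nonlin \<Omega> lam V \<psi> x =
     complex_of_real (lam x) * g_conv \<Omega> V (\<lambda>y. complex_of_real ((cmod (\<psi> y))\<^sup>2)) x * \<psi> x"

text \<open>Only the values of \<open>\<psi>\<close> on \<open>[0,T)\<close> matter; the time derivative at \<open>0\<close> is one-sided.\<close>

definition semidiscrete_solution ::
    "'a::euclidean_space set \<Rightarrow> ('a \<Rightarrow> real) \<Rightarrow> ('a \<Rightarrow> real) \<Rightarrow> ('a \<Rightarrow> real) \<Rightarrow>
     ('a \<Rightarrow> complex) set \<Rightarrow> ('a \<Rightarrow> complex) \<Rightarrow> real \<Rightarrow> (real \<Rightarrow> 'a \<Rightarrow> complex) \<Rightarrow> bool" where
  "semidiscrete_solution \<Omega> v lam V S \<psi>0 T \<psi> \<longleftrightarrow>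
     (\<forall>t\<in>{0..<T}. \<psi> t \<in> S) \<and>
     \<psi> \<in> Bochner_L2 \<Omega> T S \<and>
     (\<exists>w\<in>Bochner_L2 \<Omega> T S. is_weak_time_deriv \<Omega> T S \<psi> w) \<and>
     \<psi> 0 = \<psi>0 \<and>
     (\<forall>\<phi>\<in>S. \<forall>t\<in>{0..<T}. \<exists>D.
        ((\<lambda>\<tau>. L2_inner \<Omega> \<phi> (\<psi> \<tau>)) has_vector_derivative D) (at t within {0..<T}) \<and>
        \<i> * D = grad_inner \<Omega> \<phi> (\<psi> t)
                + L2_inner \<Omega> \<phi> (\<lambda>x. complex_of_real (v x) * \<psi> t x)
                + L2_inner \<Omega> \<phi> (f_nonlin \<Omega> lam V (\<psi> t)))"

end

theory Submission
  imports Defs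
begin

text \<open>
  The equation is a system of ordinary differential equations for the finitely many coordinates
  of \<open>\<psi>\<^sub>h\<close>. In an orthonormal basis \<open>e\<close> of \<open>S\<^sub>h\<close> it reads \<open>\<i> c\<^sub>i' = A(e\<^sub>i, u)\<close> with \<open>u = \<Sum>\<^sub>j c\<^sub>j e\<^sub>j\<close>,
  where \<open>A(\<phi>, u)\<close> is the right-hand side of the semidiscrete equation (\<open>hartree_form\<close>). Two properties of
  \<open>A\<close> decide everything. It is antilinear in \<open>\<phi>\<close> and a polynomial in the coordinates of \<open>u\<close> and their
  conjugates, hence locally Lipschitz (\<open>locally_lipschitz_hartree_form\<close>). And \<open>A(u, u)\<close> is real
  (\<open>hartree_form_diagonal_real\<close>), because all potentials are real; therefore the mass
  \<open>\<parallel>u\<parallel>\<^sup>2 = \<Sum>\<^sub>i |c\<^sub>i|\<^sup>2\<close> is conserved and the solution cannot blow up.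

  Instead of continuing local solutions, the vector field is modified away from the sphere on which
  the mass equals that of the initial value, by a real radial factor that makes it globally
  Lipschitz. A globally Lipschitz field has global solutions (\<open>lipschitz_ode_global_solution\<close>), the
  modified system still conserves mass, so its solution remains on the sphere and solves the original
  system (\<open>conservative_system_global_solution\<close>). Uniqueness is Gronwall's argument on the bounded
  set to which conservation of mass confines all solutions (\<open>conservative_system_unique\<close>).

  The analytic burden is the linearity of the gradient form. Weak derivatives enter it through an
  arbitrary choice, so linearity requires their uniqueness almost everywhere, that is, the
  fundamental lemma of the calculus of variations
  (\<open>fundamental_lemma_calculus_of_variations\<close>). Its proof needs enough smooth test functions, which are
  built from \<open>exp (- 1 / t)\<close>.

  Conversely, the solution of the coordinate system is continuously differentiable, and this
  suffices for the square integrability and the weak time derivative demanded of a semidiscrete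
  solution (\<open>continuous_coordinates_Bochner_L2\<close>, \<open>classical_derivative_is_weak_partial\<close>).
\<close>

section \<open>Globally Lipschitz differential equations\<close>

text \<open>An exponential bound on the integrand survives integration and gains the factor \<open>1 / k\<close>. This
  gain is what turns the Picard operator into a contraction for an exponentially weighted norm.\<close>

lemma norm_integral_le_exp:
  fixes g :: "real \<Rightarrow> 'b::banach"
  assumes cont: "continuous_on {0..s} g" and k: "k > 0" and s: "0 \<le> s" and C: "0 \<le> C"
    and le: "\<And>r. r \<in> {0..s} \<Longrightarrow> norm (g r) \<le> C * exp (k * r)"
  shows "norm (integral {0..s} g) \<le> C / k * exp (k * s)"
proof -
  have "((\<lambda>r. C * exp (k * r)) has_integral (C / k * exp (k * s) - C / k * exp (k * 0))) {0..s}"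
  proof (rule fundamental_theorem_of_calculus[OF s])
    fix r assume "r \<in> {0..s}"
    show "((\<lambda>r. C / k * exp (k * r)) has_vector_derivative C * exp (k * r)) (at r within {0..s})"
      unfolding has_real_derivative_iff_has_vector_derivative[symmetric]
      using k by (auto intro!: derivative_eq_intros)
  qed
  then have "norm (integral {0..s} g) \<le> C / k * exp (k * s) - C / k * exp (k * 0)"
    using integral_norm_bound_integral[OF integrable_continuous_real[OF cont] _ le]
    by (metis has_integral_integrable_integral)
  also have "\<dots> \<le> C / k * exp (k * s)" using C k by simp
  finally show ?thesis .
qed

text \<open>Picard's fixed point argument on the whole half line at once. A solution grows at most like
  \<open>exp (K * t)\<close> times a constant, so \<open>y t = exp (- 2 * K * t) *\<^sub>R x t\<close> is a bounded continuous
  function, and in terms of \<open>y\<close> the Picard operator has Lipschitz constant \<open>1/2\<close> in the supremum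
  norm.\<close>

lemma lipschitz_ode_global_solution:
  fixes G :: "'b::banach \<Rightarrow> 'b"
  assumes lip: "\<And>x y. norm (G x - G y) \<le> L * norm (x - y)"
  shows "\<exists>x. x 0 = x0 \<and> (\<forall>t\<ge>0. (x has_vector_derivative G (x t)) (at t within {0..}))"
proof -
  define K where "K = max L 1"
  have K: "K > 0" "\<And>x y. norm (G x - G y) \<le> K * norm (x - y)"
    unfolding K_def by (auto intro: order_trans[OF lip mult_right_mono])
  have "continuous_on UNIV G"
    using K by (intro lipschitz_on_continuous_on[of K] lipschitz_onI) (auto simp: dist_norm)
  then have contG: "continuous_on A (\<lambda>r. G (f r))" if "continuous_on A f" for A and f :: "real \<Rightarrow> 'b"
    using that continuous_on_compose2[of UNIV G A f] by auto
  define H where "H y r = G (exp (2 * K * r) *\<^sub>R apply_bcontfun y r)" for y :: "real \<Rightarrow>\<^sub>C 'b" and r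
  have contH: "continuous_on A (H y)" for y A
    unfolding H_def by (intro contG continuous_intros) auto
  \<comment> \<open>The Picard operator in the weighted variable. Clipping at \<open>0\<close> extends its values to negative
    times, where only boundedness and continuity matter.\<close>
  define W where "W y t = exp (- (2 * K * max 0 t)) *\<^sub>R (x0 + integral {0..max 0 t} (H y))" for y t
  have deriv_int: "((\<lambda>t. integral {0..t} (H y)) has_vector_derivative H y t) (at t within {0..})"
    if "t \<ge> 0" for y t
  proof -
    have "((\<lambda>t. integral {0..t} (H y)) has_vector_derivative H y t) (at t within {0..t+1})"
      using that by (intro integral_has_vector_derivative contH) auto
    moreover have "at t within {0..t+1} = at t within {0..}"
      by (rule at_within_nhd[of _ "{t-1<..<t+1}"]) (use that in auto)
    ultimately show ?thesis by simp
  qed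
  have cont_int: "continuous_on {0..} (\<lambda>t. integral {0..t} (H y))" for y
    using deriv_int has_vector_derivative_continuous
    by (fastforce simp: continuous_on_eq_continuous_within)
  have contW: "continuous_on UNIV (W y)" for y
    unfolding W_def
    by (intro continuous_intros continuous_on_compose2[OF cont_int]) auto
  have H_diff: "norm (H y r - H z r) \<le> K * norm (y - z) * exp (2 * K * r)" for y z r
  proof -
    have "norm (H y r - H z r) \<le> K * (exp (2 * K * r) * norm (apply_bcontfun (y - z) r))"
      unfolding H_def using K(2)[of "exp (2 * K * r) *\<^sub>R y r" "exp (2 * K * r) *\<^sub>R z r"]
      by (simp flip: scaleR_diff_right)
    also have "\<dots> \<le> K * (exp (2 * K * r) * norm (y - z))"
      using K by (intro mult_left_mono norm_bounded) auto
    finally show ?thesis by (simp add: mult_ac)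
  qed
  have W_diff: "norm (W y t - W z t) \<le> 1/2 * norm (y - z)" for y z t
  proof -
    let ?s = "max 0 t"
    have "W y t - W z t = exp (- (2 * K * ?s)) *\<^sub>R integral {0..?s} (\<lambda>r. H y r - H z r)"
      unfolding W_def
      by (simp add: integral_diff integrable_continuous_real contH flip: scaleR_diff_right)
    also have "norm \<dots> \<le> exp (- (2 * K * ?s)) * (K * norm (y - z) / (2 * K) * exp (2 * K * ?s))"
      unfolding norm_scaleR abs_exp_cancel using K
      by (intro mult_left_mono norm_integral_le_exp H_diff continuous_intros contH) auto
    also have "\<dots> = 1/2 * norm (y - z)"
      using K by (simp add: field_simps exp_minus)
    finally show ?thesis .
  qed
  have W_bcontfun: "W y \<in> bcontfun" for y
  proof (rule bcontfun_normI[OF contW])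
    fix t :: real
    let ?s = "max 0 t"
    have *: "norm (W 0 t) \<le> norm x0 + norm (G 0) / (2 * K)"
    proof -
      have "norm (integral {0..?s} (H 0)) \<le> norm (G 0) / (2 * K) * exp (2 * K * ?s)"
        using K by (intro norm_integral_le_exp contH) (auto simp: H_def mult_le_cancel_left1)
      then have "norm (W 0 t) \<le> exp (- (2 * K * ?s)) * (norm x0 + norm (G 0) / (2 * K) * exp (2 * K * ?s))"
        unfolding W_def norm_scaleR abs_exp_cancel
        by (intro mult_left_mono order_trans[OF norm_triangle_ineq] add_left_mono) auto
      also have "\<dots> = exp (- (2 * K * ?s)) * norm x0 + norm (G 0) / (2 * K)"
        using K by (simp add: field_simps exp_minus)
      also have "\<dots> \<le> norm x0 + norm (G 0) / (2 * K)"
        using K by (intro add_right_mono mult_left_le_one_le) auto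
      finally show ?thesis .
    qed
    have "norm (W y t) \<le> norm (W 0 t) + norm (W y t - W 0 t)"
      by (metis add.commute diff_add_cancel norm_triangle_ineq)
    also have "\<dots> \<le> (norm x0 + norm (G 0) / (2 * K)) + 1/2 * norm (y - 0)"
      by (intro add_mono * W_diff)
    finally show "norm (W y t) \<le> (norm x0 + norm (G 0) / (2 * K)) + 1/2 * norm (y - 0)" .
  qed
  have app: "apply_bcontfun (Bcontfun (W y)) = W y" for y
    using W_bcontfun by (simp add: Bcontfun_inverse)
  have "\<exists>!y. Bcontfun (W y) = y"
  proof (rule banach_fix_type[of "1/2"])
    show "\<forall>y z. dist (Bcontfun (W y)) (Bcontfun (W z)) \<le> 1/2 * dist y z"
    proof (intro allI dist_bound)
      fix y z t
      show "dist (Bcontfun (W y) t) (Bcontfun (W z) t) \<le> 1/2 * dist y z"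
        unfolding app dist_norm by (rule W_diff)
    qed
  qed auto
  then obtain y where "Bcontfun (W y) = y" by blast
  then have y: "apply_bcontfun y = W y" using app[of y] by simp
  define x where "x t = x0 + integral {0..t} (H y)" for t
  have Hx: "H y t = G (x t)" if "t \<ge> 0" for t
  proof -
    have "exp (2 * K * t) *\<^sub>R apply_bcontfun y t = x t"
      using that by (subst y) (simp add: W_def x_def exp_minus)
    then show ?thesis by (simp add: H_def)
  qed
  have "(x has_vector_derivative G (x t)) (at t within {0..})" if "t \<ge> 0" for t
    unfolding x_def[abs_def] using deriv_int[OF that, of y] Hx[OF that]
    by (auto simp: x_def[abs_def] intro!: derivative_eq_intros)
  moreover have "x 0 = x0" by (simp add: x_def)
  ultimately show ?thesis by blast
qed

section \<open>Conservative systems in complex coordinates\<close>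

text \<open>The dimension of a Galerkin space is a number and not a type. Points of \<open>n\<close>-dimensional
  complex space are therefore functions \<open>nat \<Rightarrow> complex\<close>, and the estimate below forces \<open>F\<close> to
  depend on the coordinates below \<open>n\<close> only.\<close>

definition lipschitz_on_polydisc :: "nat \<Rightarrow> real \<Rightarrow> real \<Rightarrow> ((nat \<Rightarrow> complex) \<Rightarrow> complex) \<Rightarrow> bool" where
  "lipschitz_on_polydisc n R L F \<longleftrightarrow> 0 \<le> L \<and>
     (\<forall>c d. (\<forall>j<n. cmod (c j) \<le> R) \<longrightarrow> (\<forall>j<n. cmod (d j) \<le> R) \<longrightarrow>
        cmod (F c - F d) \<le> L * (\<Sum>j<n. cmod (c j - d j)))"

definition locally_lipschitz :: "nat \<Rightarrow> ((nat \<Rightarrow> complex) \<Rightarrow> complex) \<Rightarrow> bool" where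
  "locally_lipschitz n F \<longleftrightarrow> (\<forall>R. \<exists>L. lipschitz_on_polydisc n R L F)"

lemma lipschitz_on_polydiscD:
  assumes "lipschitz_on_polydisc n R L F"
    and "\<And>j. j < n \<Longrightarrow> cmod (c j) \<le> R" "\<And>j. j < n \<Longrightarrow> cmod (d j) \<le> R"
  shows "cmod (F c - F d) \<le> L * (\<Sum>j<n. cmod (c j - d j))"
  using assms unfolding lipschitz_on_polydisc_def by blast

lemma lipschitz_on_polydisc_nonneg: "lipschitz_on_polydisc n R L F \<Longrightarrow> 0 \<le> L"
  by (simp add: lipschitz_on_polydisc_def)

lemma locally_lipschitz_const: "locally_lipschitz n (\<lambda>_. z)"
  unfolding locally_lipschitz_def lipschitz_on_polydisc_def by (auto intro!: exI[of _ 0])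

lemma locally_lipschitz_coord: "i < n \<Longrightarrow> locally_lipschitz n (\<lambda>c. c i)"
  unfolding locally_lipschitz_def lipschitz_on_polydisc_def
  by (auto intro!: exI[of _ 1] member_le_sum[where f = "\<lambda>j. cmod (_ j - _ j)"])

lemma locally_lipschitz_cnj: "locally_lipschitz n F \<Longrightarrow> locally_lipschitz n (\<lambda>c. cnj (F c))"
  unfolding locally_lipschitz_def lipschitz_on_polydisc_def by (simp flip: complex_cnj_diff)

lemma locally_lipschitz_add:
  assumes "locally_lipschitz n F" "locally_lipschitz n G"
  shows "locally_lipschitz n (\<lambda>c. F c + G c)"
  unfolding locally_lipschitz_def
proof
  fix R
  obtain L M where L: "lipschitz_on_polydisc n R L F" and M: "lipschitz_on_polydisc n R M G"
    using assms unfolding locally_lipschitz_def by blast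
  have "lipschitz_on_polydisc n R (L + M) (\<lambda>c. F c + G c)"
    unfolding lipschitz_on_polydisc_def
  proof (intro conjI allI impI)
    fix c d assume cd: "\<forall>j<n. cmod (c j) \<le> R" "\<forall>j<n. cmod (d j) \<le> R"
    have "cmod (F c + G c - (F d + G d)) \<le> cmod (F c - F d) + cmod (G c - G d)"
      by (metis add_diff_add norm_triangle_ineq)
    also have "\<dots> \<le> (L + M) * (\<Sum>j<n. cmod (c j - d j))"
      unfolding distrib_right
      using cd by (intro add_mono lipschitz_on_polydiscD[OF L] lipschitz_on_polydiscD[OF M]) auto
    finally show "cmod (F c + G c - (F d + G d)) \<le> (L + M) * (\<Sum>j<n. cmod (c j - d j))" .
  qed (use lipschitz_on_polydisc_nonneg[OF L] lipschitz_on_polydisc_nonneg[OF M] in simp)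
  then show "\<exists>L. lipschitz_on_polydisc n R L (\<lambda>c. F c + G c)" ..
qed

text \<open>Comparison with the value at the origin; multiplication of locally Lipschitz functions needs
  such a bound on both factors.\<close>

lemma locally_lipschitz_bounded:
  assumes "locally_lipschitz n F"
  shows "\<exists>B\<ge>0. \<forall>c. (\<forall>j<n. cmod (c j) \<le> R) \<longrightarrow> cmod (F c) \<le> B"
proof -
  obtain L where L: "lipschitz_on_polydisc n \<bar>R\<bar> L F"
    using assms unfolding locally_lipschitz_def by blast
  note L0 = lipschitz_on_polydisc_nonneg[OF L]
  show ?thesis
  proof (intro exI[of _ "cmod (F (\<lambda>_. 0)) + L * (real n * \<bar>R\<bar>)"] conjI allI impI)
    fix c assume c: "\<forall>j<n. cmod (c j) \<le> R"
    then have c': "cmod (c j) \<le> \<bar>R\<bar>" if "j < n" for j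
      using that by (meson abs_ge_self order_trans)
    have "(\<Sum>j<n. cmod (c j - 0)) \<le> real n * \<bar>R\<bar>"
      using sum_bounded_above[of "{..<n}" "\<lambda>j. cmod (c j)" "\<bar>R\<bar>"] c' by simp
    then have "L * (\<Sum>j<n. cmod (c j - 0)) \<le> L * (real n * \<bar>R\<bar>)"
      using L0 by (rule mult_left_mono)
    moreover have "cmod (F c) \<le> cmod (F (\<lambda>_. 0)) + cmod (F c - F (\<lambda>_. 0))"
      by (metis add.commute diff_add_cancel norm_triangle_ineq)
    moreover have "cmod (F c - F (\<lambda>_. 0)) \<le> L * (\<Sum>j<n. cmod (c j - 0))"
      by (rule lipschitz_on_polydiscD[OF L]) (use c' in auto)
    ultimately show "cmod (F c) \<le> cmod (F (\<lambda>_. 0)) + L * (real n * \<bar>R\<bar>)" by linarith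
  qed (use L0 in auto)
qed

lemma locally_lipschitz_mult:
  assumes "locally_lipschitz n F" "locally_lipschitz n G"
  shows "locally_lipschitz n (\<lambda>c. F c * G c)"
  unfolding locally_lipschitz_def
proof
  fix R
  obtain L M where L: "lipschitz_on_polydisc n R L F" and M: "lipschitz_on_polydisc n R M G"
    using assms unfolding locally_lipschitz_def by blast
  note nonneg = lipschitz_on_polydisc_nonneg[OF L] lipschitz_on_polydisc_nonneg[OF M]
  obtain A where A: "0 \<le> A" "\<forall>c. (\<forall>j<n. cmod (c j) \<le> R) \<longrightarrow> cmod (F c) \<le> A"
    using locally_lipschitz_bounded[OF assms(1)] by blast
  obtain B where B: "0 \<le> B" "\<forall>c. (\<forall>j<n. cmod (c j) \<le> R) \<longrightarrow> cmod (G c) \<le> B"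
    using locally_lipschitz_bounded[OF assms(2)] by blast
  have "lipschitz_on_polydisc n R (L * B + A * M) (\<lambda>c. F c * G c)"
    unfolding lipschitz_on_polydisc_def
  proof (intro conjI allI impI)
    fix c d assume cd: "\<forall>j<n. cmod (c j) \<le> R" "\<forall>j<n. cmod (d j) \<le> R"
    let ?s = "\<Sum>j<n. cmod (c j - d j)"
    have s: "0 \<le> ?s" by (simp add: sum_nonneg)
    have "F c * G c - F d * G d = (F c - F d) * G c + F d * (G c - G d)"
      by (simp add: algebra_simps)
    then have "cmod (F c * G c - F d * G d) \<le> cmod (F c - F d) * cmod (G c) + cmod (F d) * cmod (G c - G d)"
      by (metis norm_mult norm_triangle_ineq)
    also have "\<dots> \<le> (L * ?s) * B + A * (M * ?s)"
      using cd A B nonneg s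
      by (intro add_mono mult_mono lipschitz_on_polydiscD[OF L] lipschitz_on_polydiscD[OF M]) auto
    also have "\<dots> = (L * B + A * M) * ?s" by (simp add: algebra_simps)
    finally show "cmod (F c * G c - F d * G d) \<le> (L * B + A * M) * ?s" .
  qed (use nonneg A B in auto)
  then show "\<exists>L. lipschitz_on_polydisc n R L (\<lambda>c. F c * G c)" ..
qed

lemma locally_lipschitz_sum:
  assumes "\<And>i. i \<in> I \<Longrightarrow> locally_lipschitz n (F i)"
  shows "locally_lipschitz n (\<lambda>c. \<Sum>i\<in>I. F i c)"
  using assms
  by (induction I rule: infinite_finite_induct)
     (auto intro: locally_lipschitz_const locally_lipschitz_add)

lemma has_derivative_sum_cmod_squared:
  assumes "\<And>i. i < n \<Longrightarrow> ((\<lambda>\<tau>. c \<tau> i) has_vector_derivative c' i) (at t within A)"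
  shows "((\<lambda>\<tau>. \<Sum>i<n. (cmod (c \<tau> i))\<^sup>2) has_real_derivative 2 * Re (\<Sum>i<n. cnj (c t i) * c' i)) (at t within A)"
proof -
  have "((\<lambda>\<tau>. \<Sum>i<n. Re (cnj (c \<tau> i) * c \<tau> i)) has_vector_derivative
      (\<Sum>i<n. Re (cnj (c t i) * c' i + cnj (c' i) * c t i))) (at t within A)"
    using assms
    by (intro has_vector_derivative_sum bounded_linear.has_vector_derivative[OF bounded_linear_Re]
        has_vector_derivative_mult has_vector_derivative_cnj) auto
  moreover have "Re (cnj z * z) = (cmod z)\<^sup>2" for z
    by (simp add: cmod_power2) (simp add: power2_eq_square)
  moreover have "(\<Sum>i<n. Re (cnj (c t i) * c' i + cnj (c' i) * c t i)) = 2 * Re (\<Sum>i<n. cnj (c t i) * c' i)"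
    by (simp add: sum_distrib_left algebra_simps)
  ultimately show ?thesis
    by (simp add: has_real_derivative_iff_has_vector_derivative)
qed

text \<open>The Euclidean norm is conserved because its squared derivative is twice the real part of
  \<open>- \<i>\<close> times a real number. The vector field \<open>z\<close> is allowed to depend on time in order to cover
  both the original and the truncated system.\<close>

lemma sum_cmod_squared_conserved:
  assumes "\<And>i t. i < n \<Longrightarrow> 0 \<le> t \<Longrightarrow> ((\<lambda>\<tau>. c \<tau> i) has_vector_derivative - \<i> * z t i) (at t within {0..})"
    and "\<And>t. 0 \<le> t \<Longrightarrow> Im (\<Sum>i<n. cnj (c t i) * z t i) = 0"
    and "0 \<le> (t::real)"
  shows "(\<Sum>i<n. (cmod (c t i))\<^sup>2) = (\<Sum>i<n. (cmod (c 0 i))\<^sup>2)"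
proof -
  have "((\<lambda>\<tau>. \<Sum>i<n. (cmod (c \<tau> i))\<^sup>2) has_real_derivative 0) (at t within {0..})" if "t \<in> {0..}" for t
  proof -
    have "(\<Sum>i<n. cnj (c t i) * (- \<i> * z t i)) = - \<i> * (\<Sum>i<n. cnj (c t i) * z t i)"
      by (simp add: sum_distrib_left sum_negf mult_ac)
    then have "2 * Re (\<Sum>i<n. cnj (c t i) * (- \<i> * z t i)) = 0"
      using assms(2)[of t] that by simp
    then show ?thesis
      using has_derivative_sum_cmod_squared[of n c "\<lambda>i. - \<i> * z t i" t "{0..}"] assms(1) that by simp
  qed
  then have "\<exists>m. \<forall>t\<in>{0..}. (\<Sum>i<n. (cmod (c t i))\<^sup>2) = m"
    by (intro has_field_derivative_zero_constant) auto
  then show ?thesis using assms(3) by (metis atLeast_iff order_refl)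
qed


text \<open>Division by \<open>1 + |x|\<^sup>2\<close> is a rational radial truncation: it makes every coordinate bounded and
  globally Lipschitz while multiplying the vector by a positive real scalar. Writing \<open>N\<close> and \<open>M\<close> for
  the two denominators, the difference is \<open>(x j - y j) / N + y j * (M - N) / (N * M)\<close>, where
  \<open>M - N\<close> is a sum of differences of squares.\<close>

lemma radial_truncation_lipschitz:
  fixes x y :: "nat \<Rightarrow> complex"
  assumes "j < n" and d: "\<And>k. k < n \<Longrightarrow> cmod (x k - y k) \<le> d"
  shows "cmod (x j /\<^sub>R (1 + (\<Sum>k<n. (cmod (x k))\<^sup>2)) - y j /\<^sub>R (1 + (\<Sum>k<n. (cmod (y k))\<^sup>2))) \<le> (1 + 2 * real n) * d"
proof -
  define N where "N = 1 + (\<Sum>k<n. (cmod (x k))\<^sup>2)"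
  define M where "M = 1 + (\<Sum>k<n. (cmod (y k))\<^sup>2)"
  have d0: "0 \<le> d" using d[OF assms(1)] norm_ge_zero order_trans by blast
  have N1: "1 \<le> N" and M1: "1 \<le> M" by (auto simp: N_def M_def sum_nonneg)
  then have NM: "N \<le> N * M" "M \<le> N * M" by auto
  have xN: "(cmod (x k))\<^sup>2 \<le> N" if "k < n" for k
    using member_le_sum[of k "{..<n}" "\<lambda>k. (cmod (x k))\<^sup>2"] that by (simp add: N_def)
  have yM: "(cmod (y k))\<^sup>2 \<le> M" if "k < n" for k
    using member_le_sum[of k "{..<n}" "\<lambda>k. (cmod (y k))\<^sup>2"] that by (simp add: M_def)
  have amgm: "a * b \<le> (a\<^sup>2 + b\<^sup>2) / 2" for a b :: real
    using sum_squares_bound[of a b] by simp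
  have "cmod (y j) * \<bar>M - N\<bar> \<le> (\<Sum>k<n. 2 * d * (N * M))"
  proof -
    have "\<bar>M - N\<bar> \<le> (\<Sum>k<n. \<bar>(cmod (y k))\<^sup>2 - (cmod (x k))\<^sup>2\<bar>)"
      by (simp add: M_def N_def sum_abs flip: sum_subtractf)
    then have "cmod (y j) * \<bar>M - N\<bar> \<le> (\<Sum>k<n. cmod (y j) * \<bar>(cmod (y k))\<^sup>2 - (cmod (x k))\<^sup>2\<bar>)"
      by (simp add: mult_left_mono flip: sum_distrib_left)
    also have "\<dots> \<le> (\<Sum>k<n. 2 * d * (N * M))"
    proof (rule sum_mono)
      fix k assume "k \<in> {..<n}"
      then have k: "k < n" by simp
      have "(cmod (y k))\<^sup>2 - (cmod (x k))\<^sup>2 = (cmod (y k) - cmod (x k)) * (cmod (x k) + cmod (y k))"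
        by (simp add: power2_eq_square algebra_simps)
      also have "\<bar>\<dots>\<bar> \<le> d * (cmod (x k) + cmod (y k))"
        unfolding abs_mult
        using d[OF k] norm_triangle_ineq3[of "y k" "x k"] d0
        by (intro mult_mono) (auto simp: norm_minus_commute)
      finally have "cmod (y j) * \<bar>(cmod (y k))\<^sup>2 - (cmod (x k))\<^sup>2\<bar>
          \<le> cmod (y j) * (d * (cmod (x k) + cmod (y k)))"
        by (rule mult_left_mono) simp
      also have "\<dots> = d * (cmod (y j) * cmod (x k) + cmod (y j) * cmod (y k))"
        by (simp add: algebra_simps)
      also have "\<dots> \<le> d * (N * M + N * M)"
      proof (intro mult_left_mono add_mono d0)
        have "(cmod (y j) * cmod (x k))\<^sup>2 \<le> M * N"
          unfolding power_mult_distrib using xN[OF k] yM[OF assms(1)] M1 by (intro mult_mono) auto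
        also have "\<dots> \<le> (N * M)\<^sup>2"
          using order_trans[OF N1 NM(1)] self_le_power[of "N * M" 2] by (simp add: mult.commute)
        finally show "cmod (y j) * cmod (x k) \<le> N * M"
          using N1 M1 by (auto intro: power2_le_imp_le)
        show "cmod (y j) * cmod (y k) \<le> N * M"
          by (rule order_trans[OF _ NM(2)])
             (use amgm[of "cmod (y j)" "cmod (y k)"] yM[OF k] yM[OF assms(1)] in \<open>simp add: field_simps\<close>)
      qed
      finally show "cmod (y j) * \<bar>(cmod (y k))\<^sup>2 - (cmod (x k))\<^sup>2\<bar> \<le> 2 * d * (N * M)"
        by (simp add: mult_ac)
    qed
    finally show ?thesis .
  qed
  then have bound2: "cmod (y j) * \<bar>M - N\<bar> / (N * M) \<le> 2 * real n * d"
    using N1 M1 by (simp add: divide_le_eq mult_ac)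
  have "x j /\<^sub>R N - y j /\<^sub>R M = (x j - y j) /\<^sub>R N + ((M - N) / (N * M)) *\<^sub>R y j"
    using N1 M1 by (simp add: scaleR_conv_of_real field_simps)
  then have "cmod (x j /\<^sub>R N - y j /\<^sub>R M) \<le> cmod ((x j - y j) /\<^sub>R N) + cmod (((M - N) / (N * M)) *\<^sub>R y j)"
    by (metis norm_triangle_ineq)
  also have "\<dots> = cmod (x j - y j) / N + cmod (y j) * \<bar>M - N\<bar> / (N * M)"
    using N1 M1 by (simp add: divide_inverse mult_ac abs_mult)
  also have "\<dots> \<le> d + 2 * real n * d"
  proof (intro add_mono bound2)
    show "cmod (x j - y j) / N \<le> d"
      using d[OF assms(1)] N1 d0 by (simp add: divide_le_eq) (smt (verit) mult_le_cancel_left1)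
  qed
  finally show ?thesis unfolding N_def M_def by (simp add: algebra_simps)
qed

lemma radial_truncation_bounded:
  fixes x :: "nat \<Rightarrow> complex"
  assumes "j < n"
  shows "cmod (x j /\<^sub>R (1 + (\<Sum>k<n. (cmod (x k))\<^sup>2))) \<le> 1"
proof -
  have "2 * cmod (x j) \<le> (cmod (x j))\<^sup>2 + 1"
    using sum_squares_bound[of "cmod (x j)" 1] by simp
  then have "cmod (x j) \<le> 1 + (cmod (x j))\<^sup>2"
    using norm_ge_zero[of "x j"] by linarith
  also have "\<dots> \<le> 1 + (\<Sum>k<n. (cmod (x k))\<^sup>2)"
    using member_le_sum[of j "{..<n}" "\<lambda>k. (cmod (x k))\<^sup>2"] assms by simp
  finally have "cmod (x j) \<le> 1 + (\<Sum>k<n. (cmod (x k))\<^sup>2)" .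
  moreover have "0 \<le> (\<Sum>k<n. (cmod (x k))\<^sup>2)" by (simp add: sum_nonneg)
  ultimately show ?thesis by (simp add: inverse_eq_divide divide_le_eq)
qed

instance bcontfun :: (metric_space, banach) banach ..

text \<open>The field \<open>F\<close> is only locally Lipschitz. It is evaluated at \<open>q x = \<theta> x *\<^sub>R x\<close> instead of \<open>x\<close>,
  where \<open>\<theta>\<close> is a positive real factor that makes \<open>q\<close> bounded and Lipschitz and that equals \<open>1\<close> on
  the sphere \<open>|x|\<^sup>2 = m\<close> through the initial value. The modified system is globally Lipschitz, hence
  globally solvable. Since \<open>\<theta>\<close> is real, the modified system conserves \<open>|x|\<^sup>2\<close> too; its solution stays on
  the sphere, where both systems agree.\<close>

theorem conservative_system_global_solution:
  assumes lip: "\<And>i. i < n \<Longrightarrow> locally_lipschitz n (F i)"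
    and real: "\<And>c. Im (\<Sum>i<n. cnj (c i) * F i c) = 0"
  shows "\<exists>c. (\<forall>i<n. c 0 i = c0 i) \<and>
    (\<forall>t\<ge>0. \<forall>i<n. ((\<lambda>\<tau>. c \<tau> i) has_vector_derivative - \<i> * F i (c t)) (at t within {0..}))"
proof -
  define m where "m = (\<Sum>i<n. (cmod (c0 i))\<^sup>2)"
  have m: "0 \<le> m" by (simp add: m_def sum_nonneg)
  define \<theta> where "\<theta> x = (1 + m) / (1 + (\<Sum>k<n. (cmod (x k))\<^sup>2))" for x :: "nat \<Rightarrow> complex"
  define q where "q x j = \<theta> x *\<^sub>R x j" for x :: "nat \<Rightarrow> complex" and j
  have q_eq: "q x j = (1 + m) *\<^sub>R (x j /\<^sub>R (1 + (\<Sum>k<n. (cmod (x k))\<^sup>2)))" for x j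
    by (simp add: q_def \<theta>_def divide_inverse)
  have q_bound: "cmod (q x j) \<le> 1 + m" if "j < n" for x j
    using mult_left_mono[OF radial_truncation_bounded[OF that, of x], where c = "1 + m"] m
    unfolding q_eq norm_scaleR[of "1 + m"] by simp
  have q_lip: "cmod (q x j - q y j) \<le> (1 + m) * ((1 + 2 * real n) * d)"
    if "j < n" "\<And>k. k < n \<Longrightarrow> cmod (x k - y k) \<le> d" for x y j d
    using mult_left_mono[OF radial_truncation_lipschitz[OF that], where c = "1 + m"] m
    unfolding q_eq scaleR_diff_right[symmetric] norm_scaleR[of "1 + m"] by simp
  have "\<forall>i\<in>{..<n}. \<exists>L. lipschitz_on_polydisc n (1 + m) L (F i)"
    using lip unfolding locally_lipschitz_def by blast
  from bchoice[OF this] obtain L where Lip: "\<And>i. i < n \<Longrightarrow> lipschitz_on_polydisc n (1 + m) (L i) (F i)"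
    by blast
  note L = lipschitz_on_polydisc_nonneg[OF Lip] lipschitz_on_polydiscD[OF Lip]
  define g where "g x i = - \<i> * F i (q x)" for x i
  define K where "K = (\<Sum>i<n. L i * (real n * ((1 + m) * (1 + 2 * real n))))"
  have g_lip: "cmod (g x i - g y i) \<le> L i * (real n * ((1 + m) * (1 + 2 * real n))) * d"
    if i: "i < n" and d: "\<And>k. k < n \<Longrightarrow> cmod (x k - y k) \<le> d" for x y i d
  proof -
    have "cmod (g x i - g y i) = cmod (F i (q x) - F i (q y))"
      by (simp add: g_def norm_minus_commute norm_mult flip: right_diff_distrib)
    also have "\<dots> \<le> L i * (\<Sum>j<n. cmod (q x j - q y j))"
      using i by (intro L q_bound)
    also have "\<dots> \<le> L i * (real n * ((1 + m) * ((1 + 2 * real n) * d)))"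
      using L(1)[OF i] sum_bounded_above[of "{..<n}" "\<lambda>j. cmod (q x j - q y j)"
          "(1 + m) * ((1 + 2 * real n) * d)"] q_lip d
      by (intro mult_left_mono) auto
    finally show ?thesis by (simp add: mult_ac)
  qed
  \<comment> \<open>The vector field must act on a Banach space given by a type. Tent functions centred at
    \<open>0, \<dots>, n - 1\<close> embed the coordinates into the bounded continuous functions on the real line, and
    evaluation at these points recovers them.\<close>
  define tent where "tent i s = complex_of_real (max 0 (1 - \<bar>s - real i\<bar>))" for i :: nat and s
  have tent_le: "cmod (tent i s) \<le> 1" for i s by (simp add: tent_def)
  have tent_nat: "tent i (real j) = (if i = j then 1 else 0)" for i j
    unfolding tent_def by (cases i j rule: linorder_cases) auto
  have sum_le: "cmod (\<Sum>i<n. tent i s * z i) \<le> (\<Sum>i<n. cmod (z i))" for s z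
    by (rule sum_norm_le) (simp add: norm_mult mult_left_le_one_le tent_le)
  define embed where "embed z = Bcontfun (\<lambda>s. \<Sum>i<n. tent i s * z i)" for z :: "nat \<Rightarrow> complex"
  have embed: "apply_bcontfun (embed z) s = (\<Sum>i<n. tent i s * z i)" for z s
    unfolding embed_def
  proof (subst Bcontfun_inverse)
    show "(\<lambda>s. \<Sum>i<n. tent i s * z i) \<in> bcontfun"
      by (rule bcontfun_normI[OF _ sum_le]) (auto simp: tent_def intro!: continuous_intros)
  qed simp
  have embed_nat: "apply_bcontfun (embed z) (real i) = z i" if "i < n" for z i
    using that by (simp add: embed tent_nat if_distrib[of "\<lambda>w. w * _"] cong: if_cong)
  define G where "G x = embed (g (\<lambda>j. apply_bcontfun x (real j)))" for x :: "real \<Rightarrow>\<^sub>C complex"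
  have "norm (G x - G y) \<le> K * norm (x - y)" for x y
  proof (rule norm_bound)
    fix s
    let ?g = "\<lambda>x. g (\<lambda>j. apply_bcontfun x (real j))"
    have "norm (apply_bcontfun (G x - G y) s) = cmod (\<Sum>i<n. tent i s * (?g x i - ?g y i))"
      by (simp add: G_def embed right_diff_distrib sum_subtractf)
    also have "\<dots> \<le> (\<Sum>i<n. L i * (real n * ((1 + m) * (1 + 2 * real n))) * norm (x - y))"
      by (intro order_trans[OF sum_le] sum_mono g_lip norm_bounded[of "x - y", simplified]) auto
    finally show "norm (apply_bcontfun (G x - G y) s) \<le> K * norm (x - y)"
      by (simp add: K_def sum_distrib_right)
  qed
  then obtain x where x0: "x 0 = embed c0"
    and x: "\<And>t. 0 \<le> t \<Longrightarrow> (x has_vector_derivative G (x t)) (at t within {0..})"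
    using lipschitz_ode_global_solution[of G K "embed c0"] by blast
  define c where "c t i = apply_bcontfun (x t) (real i)" for t i
  have c0: "c 0 i = c0 i" if "i < n" for i
    using that by (simp add: c_def x0 embed_nat)
  have eval: "bounded_linear (\<lambda>x :: real \<Rightarrow>\<^sub>C complex. apply_bcontfun x s)" for s
    by (rule bounded_linear_intro[of _ 1]) (auto intro: norm_bounded)
  have c: "((\<lambda>\<tau>. c \<tau> i) has_vector_derivative - \<i> * F i (q (c t))) (at t within {0..})"
    if "i < n" "0 \<le> t" for i t
    using bounded_linear.has_vector_derivative[OF eval[of "real i"] x[OF that(2)]] that(1)
    by (simp add: c_def[abs_def] G_def embed_nat g_def)
  have mass: "(\<Sum>i<n. (cmod (c t i))\<^sup>2) = m" if "0 \<le> t" for t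
  proof -
    have "Im (\<Sum>i<n. cnj (c t i) * F i (q (c t))) = 0" for t
    proof -
      have "1 + (\<Sum>k<n. (cmod (c t k))\<^sup>2) > 0"
        by (smt (verit) sum_nonneg zero_le_power2)
      then have \<theta>: "\<theta> (c t) > 0"
        unfolding \<theta>_def using m by (intro divide_pos_pos) auto
      have "\<theta> (c t) *\<^sub>R (\<Sum>i<n. cnj (c t i) * F i (q (c t))) = (\<Sum>i<n. cnj (q (c t) i) * F i (q (c t)))"
        by (simp add: q_def scaleR_sum_right)
      from arg_cong[OF this, of Im] show ?thesis
        using real[of "q (c t)"] \<theta> by (simp del: Im_sum)
    qed
    then show ?thesis
      using sum_cmod_squared_conserved[of n c "\<lambda>t i. F i (q (c t))" t] c that c0
      by (simp add: m_def)
  qed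
  have "q (c t) = c t" if "0 \<le> t" for t
    using mass[OF that] m by (auto simp: q_def \<theta>_def)
  then show ?thesis
    using c0 c by (intro exI[of _ c]) auto
qed

text \<open>Two solutions stay in one polydisc, because their norms are conserved. On it the field is
  Lipschitz, so the squared distance \<open>D\<close> satisfies \<open>D' \<le> k * D\<close> and \<open>exp (- k * t) * D t\<close> cannot
  increase from its initial value \<open>0\<close>.\<close>

theorem conservative_system_unique:
  fixes c d :: "real \<Rightarrow> nat \<Rightarrow> complex"
  assumes lip: "\<And>i. i < n \<Longrightarrow> locally_lipschitz n (F i)"
    and real: "\<And>c. Im (\<Sum>i<n. cnj (c i) * F i c) = 0"
    and c: "\<And>i t. i < n \<Longrightarrow> 0 \<le> t \<Longrightarrow> ((\<lambda>\<tau>. c \<tau> i) has_vector_derivative - \<i> * F i (c t)) (at t within {0..})"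
    and d: "\<And>i t. i < n \<Longrightarrow> 0 \<le> t \<Longrightarrow> ((\<lambda>\<tau>. d \<tau> i) has_vector_derivative - \<i> * F i (d t)) (at t within {0..})"
    and init: "\<And>i. i < n \<Longrightarrow> c 0 i = d 0 i"
    and t: "0 \<le> t" and i: "i < n"
  shows "c t i = d t i"
proof -
  define R where "R = sqrt (\<Sum>i<n. (cmod (c 0 i))\<^sup>2)"
  have bound: "cmod (e t j) \<le> R"
    if "0 \<le> t" "j < n" and e: "\<And>i t. i < n \<Longrightarrow> 0 \<le> t \<Longrightarrow> ((\<lambda>\<tau>. e \<tau> i) has_vector_derivative - \<i> * F i (e t)) (at t within {0..})"
      and e0: "\<And>i. i < n \<Longrightarrow> e 0 i = c 0 i"
    for e :: "real \<Rightarrow> nat \<Rightarrow> complex" and t j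
  proof -
    have "(cmod (e t j))\<^sup>2 \<le> (\<Sum>i<n. (cmod (e t i))\<^sup>2)"
      using that by (intro member_le_sum[where f = "\<lambda>i. (cmod (e t i))\<^sup>2"]) auto
    also have "\<dots> = (\<Sum>i<n. (cmod (c 0 i))\<^sup>2)"
      using sum_cmod_squared_conserved[of n e "\<lambda>t i. F i (e t)" t] e real that(1) e0 by simp
    finally show ?thesis unfolding R_def by (rule real_le_rsqrt)
  qed
  have "\<forall>i\<in>{..<n}. \<exists>L. lipschitz_on_polydisc n R L (F i)"
    using lip unfolding locally_lipschitz_def by blast
  from bchoice[OF this] obtain L where Lip: "\<And>i. i < n \<Longrightarrow> lipschitz_on_polydisc n R (L i) (F i)"
    by blast
  note L = lipschitz_on_polydisc_nonneg[OF Lip] lipschitz_on_polydiscD[OF Lip]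
  define M where "M = (\<Sum>i<n. L i)"
  have LM: "L i \<le> M" if "i < n" for i
    unfolding M_def using that L(1) by (intro member_le_sum) auto
  define D where "D t = (\<Sum>i<n. (cmod (c t i - d t i))\<^sup>2)" for t
  define D' where "D' t = 2 * Re (\<Sum>i<n. cnj (c t i - d t i) * (- \<i> * F i (c t) - - \<i> * F i (d t)))" for t
  have deriv: "(D has_real_derivative D' t) (at t within {0..})" if "0 \<le> t" for t
    unfolding D_def[abs_def] D'_def
    by (rule has_derivative_sum_cmod_squared[where c = "\<lambda>t i. c t i - d t i"])
       (intro has_vector_derivative_diff c d that)
  define k where "k = 2 * M * real n"
  have D'_le: "D' t \<le> k * D t" if "0 \<le> t" for t
  proof -
    let ?s = "\<Sum>j<n. cmod (c t j - d t j)"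
    have "D' t \<le> 2 * (\<Sum>i<n. cmod (cnj (c t i - d t i) * (- \<i> * F i (c t) - - \<i> * F i (d t))))"
      unfolding D'_def by (intro mult_left_mono order_trans[OF complex_Re_le_cmod norm_sum]) auto
    also have "\<dots> \<le> 2 * (\<Sum>i<n. cmod (c t i - d t i) * (M * ?s))"
    proof (intro mult_left_mono sum_mono)
      fix i assume "i \<in> {..<n}"
      then have i: "i < n" by simp
      have "cmod (- \<i> * F i (c t) - - \<i> * F i (d t)) = cmod (F i (c t) - F i (d t))"
        by (simp add: norm_minus_commute norm_mult flip: right_diff_distrib)
      also have "\<dots> \<le> L i * ?s"
        using that init by (intro L i bound[of t _ c] bound[of t _ d] c d) auto
      also have "\<dots> \<le> M * ?s"
        by (intro mult_right_mono LM i sum_nonneg) auto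
      finally show "cmod (cnj (c t i - d t i) * (- \<i> * F i (c t) - - \<i> * F i (d t))) \<le> cmod (c t i - d t i) * (M * ?s)"
        unfolding norm_mult complex_mod_cnj by (intro mult_left_mono) auto
    qed auto
    also have "\<dots> = 2 * M * ?s\<^sup>2"
      unfolding sum_distrib_right[symmetric] by (simp add: power2_eq_square mult_ac)
    also have "\<dots> \<le> 2 * M * (real n * D t)"
    proof (rule mult_left_mono)
      show "?s\<^sup>2 \<le> real n * D t"
        using sum_squared_le_sum_of_squares[of "\<lambda>j. cmod (c t j - d t j)" "{..<n}"] by (simp add: D_def mult.commute)
      show "0 \<le> 2 * M" unfolding M_def by (intro mult_nonneg_nonneg sum_nonneg L(1)) auto
    qed
    finally show ?thesis by (simp add: k_def mult_ac)
  qed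
  define E where "E t = exp (- k * t) * D t" for t
  have E: "(E has_real_derivative exp (- k * t) * (D' t - k * D t)) (at t within {0..})" if "0 \<le> t" for t
    unfolding E_def[abs_def] using deriv[OF that]
    by (auto intro!: derivative_eq_intros simp: algebra_simps)
  have "E t \<le> E 0"
  proof (cases "t = 0")
    case False
    have "continuous_on {0..} E"
      using E DERIV_continuous by (fastforce simp: continuous_on_eq_continuous_within)
    then have "continuous_on {0..t} E" by (rule continuous_on_subset) auto
    moreover have "(E has_derivative (\<lambda>h. exp (- k * s) * (D' s - k * D s) * h)) (at s)" if "0 < s" for s
    proof -
      have "at s within {0..} = at s"
        using that by (intro at_within_interior) (auto simp: interior_real_atLeast)
      then show ?thesis using E[of s] that by (simp add: has_field_derivative_def)
    qed
    ultimately obtain s where s: "0 < s" "E t - E 0 = exp (- k * s) * (D' s - k * D s) * (t - 0)"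
      using mvt[of 0 t E "\<lambda>s h. exp (- k * s) * (D' s - k * D s) * h"] False t by auto
    then show ?thesis
      using D'_le[of s] t mult_nonneg_nonpos[of "exp (- k * s)" "D' s - k * D s"]
        mult_nonneg_nonpos2[of t "exp (- k * s) * (D' s - k * D s)"] by simp
  qed simp
  also have "E 0 = 0" using init by (simp add: E_def D_def)
  finally have "D t \<le> 0" by (simp add: E_def mult_le_0_iff)
  moreover have "(cmod (c t i - d t i))\<^sup>2 \<le> D t"
    unfolding D_def using i by (intro member_le_sum[where f = "\<lambda>i. (cmod (c t i - d t i))\<^sup>2"]) auto
  ultimately have "(cmod (c t i - d t i))\<^sup>2 \<le> 0" by linarith
  then show ?thesis by simp
qed

section \<open>Smooth bump functions on boxes\<close>

text \<open>The \<open>m\<close>-th derivative of \<open>exp (- 1 / t)\<close> is a polynomial in \<open>1 / t\<close> times \<open>exp (- 1 / t)\<close>.\<close>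

primrec flat_poly :: "nat \<Rightarrow> real poly" where
  "flat_poly 0 = 1"
| "flat_poly (Suc m) = [:0, 0, 1:] * (flat_poly m - pderiv (flat_poly m))"

definition flat_deriv :: "nat \<Rightarrow> real \<Rightarrow> real" where
  "flat_deriv m t = (if 0 < t then poly (flat_poly m) (1 / t) * exp (- (1 / t)) else 0)"

lemma poly_times_exp_minus_tendsto_0: "((\<lambda>s. poly p s * exp (- s)) \<longlongrightarrow> (0::real)) at_top"
proof -
  have "((\<lambda>s. \<Sum>i\<le>degree p. coeff p i * (s ^ i / exp s)) \<longlongrightarrow> (\<Sum>i\<le>degree p. coeff p i * 0)) at_top"
    by (intro tendsto_intros tendsto_power_div_exp_0)
  then show ?thesis
    by (simp add: poly_altdef sum_distrib_right exp_minus divide_inverse mult.assoc)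
qed

text \<open>Away from \<open>0\<close> this is the product rule. At \<open>0\<close> the difference quotient from the right is again
  a polynomial in \<open>1 / h\<close> times \<open>exp (- 1 / h)\<close> and tends to \<open>0\<close>, so all derivatives vanish there.\<close>

lemma flat_deriv_DERIV: "(flat_deriv m has_real_derivative flat_deriv (Suc m) t) (at t)"
proof (cases t "0::real" rule: linorder_cases)
  case less
  have "((\<lambda>_. 0) has_real_derivative flat_deriv (Suc m) t) (at t)"
    using less by (simp add: flat_deriv_def)
  then show ?thesis
    by (rule has_field_derivative_transform_within_open[where S = "{..<0}"])
       (use less in \<open>auto simp: flat_deriv_def\<close>)
next
  case greater
  have "((\<lambda>t. poly (flat_poly m) (1 / t) * exp (- (1 / t))) has_real_derivative flat_deriv (Suc m) t) (at t)"
    using greater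
    by (auto intro!: derivative_eq_intros simp: flat_deriv_def field_simps power2_eq_square)
  then show ?thesis
    by (rule has_field_derivative_transform_within_open[where S = "{0<..}"])
       (use greater in \<open>auto simp: flat_deriv_def\<close>)
next
  case equal
  have "((\<lambda>h. flat_deriv m h / h) \<longlongrightarrow> 0) (at_left 0)"
    by (rule tendsto_eventually)
       (auto simp: flat_deriv_def eventually_at_filter intro!: always_eventually)
  moreover have "((\<lambda>h. flat_deriv m h / h) \<longlongrightarrow> 0) (at_right 0)"
  proof (rule Lim_transform_eventually)
    have "filterlim (\<lambda>h::real. 1 / h) at_top (at_right 0)"
      using filterlim_inverse_at_top_right by (simp add: inverse_eq_divide)
    then show "((\<lambda>h. poly (pCons 0 (flat_poly m)) (1 / h) * exp (- (1 / h))) \<longlongrightarrow> 0) (at_right 0)"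
      by (rule filterlim_compose[OF poly_times_exp_minus_tendsto_0])
    show "\<forall>\<^sub>F h in at_right 0. poly (pCons 0 (flat_poly m)) (1 / h) * exp (- (1 / h)) = flat_deriv m h / h"
      by (auto simp: eventually_at_filter flat_deriv_def intro!: always_eventually)
  qed
  ultimately have "((\<lambda>h. flat_deriv m h / h) \<longlongrightarrow> 0) (at 0)"
    by (simp add: filterlim_at_split)
  then show ?thesis
    using equal by (simp add: DERIV_def) (simp add: flat_deriv_def)
qed

lemma C_k_const: "C_k k (\<lambda>_ :: 'a::euclidean_space. c)"
proof (induction k arbitrary: c)
  case (Suc k)
  have "partial_deriv b (\<lambda>_. c) = (\<lambda>_. 0)" for b :: 'a
    by (simp add: partial_deriv_def fun_eq_iff)
  then show ?case using Suc by simp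
qed simp

lemma C_k_SucD: "C_k (Suc k) f \<Longrightarrow> C_k k f"
proof (induction k arbitrary: f)
  case 0
  then show ?case
    by (auto intro!: continuous_at_imp_continuous_on differentiable_imp_continuous_within)
qed auto

lemma C_k_add:
  assumes "C_k k f" "C_k k g"
  shows "C_k k (\<lambda>x. f x + g x)"
  using assms
proof (induction k arbitrary: f g)
  case 0
  then show ?case by (auto intro: continuous_intros)
next
  case (Suc k)
  have "partial_deriv b (\<lambda>x. f x + g x) = (\<lambda>x. partial_deriv b f x + partial_deriv b g x)" for b
  proof
    fix x
    have "((\<lambda>x. f x + g x) has_derivative
        (\<lambda>h. frechet_derivative f (at x) h + frechet_derivative g (at x) h)) (at x)"
      using Suc.prems by (intro has_derivative_add) (auto simp flip: frechet_derivative_works)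
    from frechet_derivative_at[OF this, symmetric]
    show "partial_deriv b (\<lambda>x. f x + g x) x = partial_deriv b f x + partial_deriv b g x"
      by (simp add: partial_deriv_def)
  qed
  with Suc show ?case by simp
qed

lemma C_k_mult:
  fixes f g :: "'a::euclidean_space \<Rightarrow> 'b::real_normed_algebra"
  assumes "C_k k f" "C_k k g"
  shows "C_k k (\<lambda>x. f x * g x)"
  using assms
proof (induction k arbitrary: f g)
  case 0
  then show ?case by (auto intro: continuous_intros)
next
  case (Suc k)
  have "partial_deriv b (\<lambda>x. f x * g x) = (\<lambda>x. f x * partial_deriv b g x + partial_deriv b f x * g x)" for b
  proof
    fix x
    have "((\<lambda>x. f x * g x) has_derivative
        (\<lambda>h. f x * frechet_derivative g (at x) h + frechet_derivative f (at x) h * g x)) (at x)"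
      using Suc.prems by (intro has_derivative_mult) (auto simp flip: frechet_derivative_works)
    from frechet_derivative_at[OF this, symmetric]
    show "partial_deriv b (\<lambda>x. f x * g x) x = f x * partial_deriv b g x + partial_deriv b f x * g x"
      by (simp add: partial_deriv_def)
  qed
  moreover have "C_k k f" "C_k k g" using Suc.prems C_k_SucD by blast+
  ultimately show ?case
    using Suc by (auto intro!: C_k_add differentiable_mult)
qed

lemma C_k_prod:
  fixes f :: "'i \<Rightarrow> 'a::euclidean_space \<Rightarrow> 'b::{real_normed_algebra, comm_ring_1}"
  assumes "\<And>i. i \<in> I \<Longrightarrow> C_k k (f i)"
  shows "C_k k (\<lambda>x. \<Prod>i\<in>I. f i x)"
  using assms
  by (induction I rule: infinite_finite_induct) (auto intro: C_k_const C_k_mult)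

text \<open>The partial derivatives of such a plane wave profile are constant multiples of profiles of the same
  kind, with the next derivative of the flat function. The induction therefore carries the factor \<open>c\<close>.\<close>

lemma C_k_flat_deriv:
  fixes b :: "'a::euclidean_space" and c :: complex
  shows "C_k k (\<lambda>x. c * complex_of_real (flat_deriv m (\<alpha> * (x \<bullet> b) + \<beta>)))"
proof (induction k arbitrary: m c)
  have deriv: "((\<lambda>x. c * complex_of_real (flat_deriv m (\<alpha> * (x \<bullet> b) + \<beta>))) has_derivative
     (\<lambda>h. c * complex_of_real (flat_deriv (Suc m) (\<alpha> * (x \<bullet> b) + \<beta>) * (\<alpha> * (h \<bullet> b))))) (at x)"
    for m c x
  proof -
    have lin: "((\<lambda>x. \<alpha> * (x \<bullet> b) + \<beta>) has_derivative (\<lambda>h. \<alpha> * (h \<bullet> b))) (at x)"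
      by (auto intro!: derivative_eq_intros)
    have flat: "(flat_deriv m has_derivative (\<lambda>h. flat_deriv (Suc m) (\<alpha> * (x \<bullet> b) + \<beta>) * h))
        (at (\<alpha> * (x \<bullet> b) + \<beta>))"
      using flat_deriv_DERIV unfolding has_field_derivative_def .
    note re = bounded_linear.has_derivative[OF bounded_linear_of_real has_derivative_compose[OF lin flat]]
    show ?thesis
      using bounded_linear.has_derivative[OF bounded_linear_mult_right[of c] re] .
  qed
  {
    case 0
    show ?case
      using deriv has_derivative_continuous by (fastforce simp: continuous_on_eq_continuous_at)
  next
    case (Suc k)
    have "partial_deriv b' (\<lambda>x. c * complex_of_real (flat_deriv m (\<alpha> * (x \<bullet> b) + \<beta>))) =
      (\<lambda>x. (c * complex_of_real (\<alpha> * (b' \<bullet> b))) * complex_of_real (flat_deriv (Suc m) (\<alpha> * (x \<bullet> b) + \<beta>)))" for b'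
      by (rule ext) (simp add: partial_deriv_def frechet_derivative_at[OF deriv, symmetric])
    moreover have "(\<lambda>x. c * complex_of_real (flat_deriv m (\<alpha> * (x \<bullet> b) + \<beta>))) differentiable (at x)" for x
      using deriv unfolding differentiable_def by blast
    ultimately show ?case
      using Suc by (simp only: C_k.simps) blast
  }
qed

text \<open>Because \<open>flat_deriv 0 (k * t) = (flat_deriv 0 t) powr (1 / k)\<close> for \<open>t > 0\<close>, growing \<open>k\<close> amounts to
  taking higher and higher roots of one fixed bump function on the box; these roots tend to \<open>1\<close>
  everywhere inside.\<close>

definition box_bump :: "real \<Rightarrow> 'a::euclidean_space \<Rightarrow> 'a \<Rightarrow> 'a \<Rightarrow> complex" where
  "box_bump k a b x = (\<Prod>e\<in>Basis. complex_of_real (flat_deriv 0 (k * ((x - a) \<bullet> e))) *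
      complex_of_real (flat_deriv 0 (k * ((b - x) \<bullet> e))))"

lemma smooth_box_bump: "smooth (box_bump k a b)"
proof -
  have *: "C_k i (\<lambda>x. complex_of_real (flat_deriv 0 (\<alpha> * (x \<bullet> e) + \<beta>)))" for i and e :: 'a and \<alpha> \<beta>
    using C_k_flat_deriv[of i 1] by simp
  have "C_k i (\<lambda>x. \<Prod>e\<in>Basis. complex_of_real (flat_deriv 0 (k * (x \<bullet> e) + - (k * (a \<bullet> e)))) *
      complex_of_real (flat_deriv 0 ((- k) * (x \<bullet> e) + k * (b \<bullet> e))))" for i
    by (intro C_k_prod C_k_mult *)
  then show ?thesis
    unfolding smooth_def box_bump_def[abs_def]
    by (simp add: inner_diff_left right_diff_distrib)
qed

lemma flat_deriv_0_bounds: "0 \<le> flat_deriv 0 t" "flat_deriv 0 t \<le> 1"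
  by (auto simp: flat_deriv_def)

lemma box_bump_eq_0: "x \<notin> box a b \<Longrightarrow> 0 < k \<Longrightarrow> box_bump k a b x = 0"
  unfolding box_bump_def
  by (auto simp: mem_box flat_deriv_def inner_diff_left zero_less_mult_iff intro!: prod_zero)

lemma norm_box_bump_le_1: "cmod (box_bump k a b x) \<le> 1"
  unfolding box_bump_def prod_norm[symmetric] norm_mult
  using flat_deriv_0_bounds by (intro prod_le_1) (auto intro!: mult_le_one)

lemma box_bump_in_C0_infinity:
  assumes "0 < k" "cbox a b \<subseteq> \<Omega>"
  shows "box_bump k a b \<in> C0_infinity \<Omega>"
proof -
  have "{x. box_bump k a b x \<noteq> 0} \<subseteq> cbox a b"
    using box_bump_eq_0[OF _ assms(1)] box_subset_cbox by blast
  then have "closure {x. box_bump k a b x \<noteq> 0} \<subseteq> cbox a b"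
    by (rule closure_minimal) (rule closed_cbox)
  moreover from this have "compact (closure {x. box_bump k a b x \<noteq> 0})"
    by (meson bounded_cbox bounded_subset closed_closure compact_eq_bounded_closed)
  ultimately show ?thesis
    using assms(2) smooth_box_bump by (auto simp: C0_infinity_def)
qed

lemma flat_deriv_0_tendsto_1: "0 < t \<Longrightarrow> (\<lambda>n. flat_deriv 0 (real (Suc n) * t)) \<longlonglongrightarrow> 1"
proof -
  assume t: "0 < t"
  have "(\<lambda>n. exp (- (inverse (real (Suc n)) * (1 / t)))) \<longlonglongrightarrow> exp (- (0 * (1 / t)))"
    by (intro tendsto_intros LIMSEQ_inverse_real_of_nat)
  moreover have "flat_deriv 0 (real (Suc n) * t) = exp (- (inverse (real (Suc n)) * (1 / t)))" for n
    using t by (simp add: flat_deriv_def inverse_eq_divide del: of_nat_Suc)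
  ultimately show ?thesis by simp
qed

lemma box_bump_tendsto_indicator: "(\<lambda>n. box_bump (real (Suc n)) a b x) \<longlonglongrightarrow> indicator (box a b) x"
proof (cases "x \<in> box a b")
  case True
  have "(\<lambda>n. box_bump (real (Suc n)) a b x) \<longlonglongrightarrow> (\<Prod>e\<in>(Basis::'a set). complex_of_real 1 * complex_of_real 1)"
    unfolding box_bump_def using True
    by (intro tendsto_intros flat_deriv_0_tendsto_1) (auto simp: mem_box inner_diff_left)
  then show ?thesis using True by simp
next
  case False
  then show ?thesis by (simp add: box_bump_eq_0 del: of_nat_Suc)
qed

section \<open>The fundamental lemma of the calculus of variations\<close>

lemma set_integrable_subset_lebesgue:
  fixes u :: "'a::euclidean_space \<Rightarrow> 'b::{banach, second_countable_topology}"
  assumes "integrable lebesgue u" "A \<in> sets lebesgue"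
  shows "set_integrable lebesgue A u"
  using integrable_mult_indicator[OF assms(2,1)] by (simp add: set_integrable_def)

text \<open>The sets on which the integral of \<open>u\<close> vanishes form a Dynkin system that contains the boxes, and
  boxes are closed under intersection and generate the Borel sets. So the integral vanishes on the
  Borel set where a Borel version of \<open>u\<close> is positive, which makes that set null.\<close>

lemma AE_nonpos_if_box_integrals_zero:
  fixes u :: "'a::euclidean_space \<Rightarrow> real"
  assumes int: "integrable lebesgue u"
    and box: "\<And>a b. set_lebesgue_integral lebesgue (box a b) u = 0"
  shows "AE x in lebesgue. u x \<le> 0"
proof -
  note int_set = set_integrable_subset_lebesgue[OF int]
  have total: "set_lebesgue_integral lebesgue UNIV u = 0"
  proof -
    define B where "B n = (box (- (real n *\<^sub>R One)) (real n *\<^sub>R One) :: 'a set)" for n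
    have "(\<lambda>n. set_lebesgue_integral lebesgue (B n) u) \<longlonglongrightarrow> set_lebesgue_integral lebesgue (\<Union>n. B n) u"
    proof (intro set_integral_cont_up int_set)
      show "incseq B" unfolding B_def incseq_def
        by (auto simp: mem_box) (smt (verit) of_nat_le_iff inner_Basis)+
    qed (auto simp: B_def)
    moreover have "(\<Union>n. B n) = UNIV"
      unfolding B_def by (rule UN_box_eq_UNIV)
    ultimately show ?thesis
      by (simp add: B_def box LIMSEQ_const_iff)
  qed
  have borel_zero: "set_lebesgue_integral lebesgue A u = 0" if A: "A \<in> sets borel" for A
  proof -
    let ?G = "range (\<lambda>(a, b). box a b :: 'a set)"
    have "Int_stable ?G" "?G \<subseteq> Pow UNIV" "A \<in> sigma_sets UNIV ?G"
      using A by (auto simp: Int_stable_def box_Int_box borel_eq_box)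
    then show ?thesis
    proof (induction rule: sigma_sets_induct_disjoint)
      case (basic A)
      then show ?case using box by auto
    next
      case empty
      then show ?case by (simp add: set_lebesgue_integral_def)
    next
      case (compl A)
      then have A: "A \<in> sets borel" by (simp add: borel_eq_box)
      have "set_lebesgue_integral lebesgue (UNIV - A) u + set_lebesgue_integral lebesgue A u
          = set_lebesgue_integral lebesgue ((UNIV - A) \<union> A) u"
        using A by (intro set_integral_Un[symmetric] int_set) auto
      then show ?case using compl total by simp
    next
      case (union A)
      then have "A i \<in> sets borel" for i by (subst borel_eq_box) auto
      then have A: "A i \<in> sets lebesgue" for i by simp
      have "set_lebesgue_integral lebesgue (\<Union>i. A i) u = (\<Sum>i. set_lebesgue_integral lebesgue (A i) u)"
        using union A by (intro lebesgue_integral_countable_add int_set)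
          (auto simp: disjoint_family_on_def)
      then show ?case using union by simp
    qed
  qed
  obtain u' where u': "u' \<in> borel_measurable lborel" and eq: "AE x in lborel. u x = u' x"
    using completion_ex_borel_measurable_real[of u lborel] int by auto
  \<comment> \<open>A Borel version is needed, as the vanishing of integrals is known for Borel sets only.\<close>
  define A where "A = {x. 0 < u' x}"
  have A: "A \<in> sets borel" using u' by (simp add: A_def)
  have eq': "AE x in lebesgue. u x = u' x" using eq by (rule AE_completion)
  have "AE x in lebesgue. indicator A x *\<^sub>R u x = 0"
  proof (subst integral_nonneg_eq_0_iff_AE[symmetric])
    show "integrable lebesgue (\<lambda>x. indicator A x *\<^sub>R u x)"
      using A int by (intro integrable_mult_indicator) auto
    show "AE x in lebesgue. 0 \<le> indicator A x *\<^sub>R u x"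
      using eq' by eventually_elim (auto simp: A_def indicator_def)
    show "(\<integral>x. indicator A x *\<^sub>R u x \<partial>lebesgue) = 0"
      using borel_zero[OF A] by (simp add: set_lebesgue_integral_def)
  qed
  with eq' show ?thesis
    by eventually_elim (auto simp: A_def indicator_def split: if_splits)
qed

text \<open>The real case applied to the real and imaginary parts and their negatives.\<close>

lemma AE_zero_if_box_integrals_zero:
  fixes u :: "'a::euclidean_space \<Rightarrow> complex"
  assumes int: "integrable lebesgue u"
    and box: "\<And>a b. set_lebesgue_integral lebesgue (box a b) u = 0"
  shows "AE x in lebesgue. u x = 0"
proof -
  have ReIm: "AE x in lebesgue. f (u x) \<le> 0" if f: "bounded_linear f" for f :: "complex \<Rightarrow> real"
  proof (rule AE_nonpos_if_box_integrals_zero)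
    interpret bounded_linear f by (rule f)
    show "integrable lebesgue (\<lambda>x. f (u x))"
      by (rule integrable_bounded_linear[OF f int])
    fix a b :: 'a
    have "(\<integral>x. f (indicator (box a b) x *\<^sub>R u x) \<partial>lebesgue) = f (\<integral>x. indicator (box a b) x *\<^sub>R u x \<partial>lebesgue)"
      using int by (intro integral_bounded_linear[OF f] integrable_mult_indicator) auto
    then show "set_lebesgue_integral lebesgue (box a b) (\<lambda>x. f (u x)) = 0"
      using box[of a b] by (simp add: set_lebesgue_integral_def scaleR zero)
  qed
  have "AE x in lebesgue. Re (u x) \<le> 0" "AE x in lebesgue. - Re (u x) \<le> 0"
       "AE x in lebesgue. Im (u x) \<le> 0" "AE x in lebesgue. - Im (u x) \<le> 0"
    by (intro ReIm bounded_linear_Re bounded_linear_Im bounded_linear_minus)+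
  then show ?thesis
    by eventually_elim (simp add: complex_eq_iff)
qed

text \<open>This makes the integrals in the definition of weak derivatives genuine: for a function that is
  not integrable the integral is \<open>0\<close> by convention, and linearity would fail.\<close>

lemma set_integrable_times_compactly_supported:
  fixes w g :: "'a::euclidean_space \<Rightarrow> complex"
  assumes w: "locally_integrable \<Omega> w"
    and g: "continuous_on UNIV g"
    and K: "compact K" "K \<subseteq> \<Omega>" "\<And>x. x \<notin> K \<Longrightarrow> g x = 0"
  shows "set_integrable lebesgue \<Omega> (\<lambda>x. w x * g x)"
proof -
  have "bounded (g ` K)"
    using g K(1) by (meson compact_continuous_image compact_imp_bounded continuous_on_subset subset_UNIV)
  then obtain B where B: "\<And>x. x \<in> K \<Longrightarrow> cmod (g x) \<le> B"
    unfolding bounded_iff by auto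
  have int: "integrable lebesgue (\<lambda>x. indicator K x *\<^sub>R w x)"
    using w K unfolding locally_integrable_def set_integrable_def by blast
  have "integrable lebesgue (\<lambda>x. (indicator K x *\<^sub>R w x) * g x)"
  proof (rule Bochner_Integration.integrable_bound[where f = "\<lambda>x. B *\<^sub>R (indicator K x *\<^sub>R w x)"])
    show "integrable lebesgue (\<lambda>x. B *\<^sub>R (indicator K x *\<^sub>R w x))"
      using int by (rule integrable_scaleR_right)
    have "g \<in> borel_measurable lebesgue"
      using borel_measurable_continuous_onI[OF g] by (simp add: measurable_completion)
    then show "(\<lambda>x. (indicator K x *\<^sub>R w x) * g x) \<in> borel_measurable lebesgue"
      by (intro borel_measurable_times borel_measurable_integrable[OF int])
    show "AE x in lebesgue. norm ((indicator K x *\<^sub>R w x) * g x) \<le> norm (B *\<^sub>R (indicator K x *\<^sub>R w x))"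
    proof (intro AE_I2)
      fix x
      show "norm ((indicator K x *\<^sub>R w x) * g x) \<le> norm (B *\<^sub>R (indicator K x *\<^sub>R w x))"
        using B[of x] order_trans[OF norm_ge_zero, OF B[of x]]
        by (auto simp: indicator_def norm_mult mult.commute intro!: mult_right_mono)
    qed
  qed
  also have "(\<lambda>x. (indicator K x *\<^sub>R w x) * g x) = (\<lambda>x. indicator \<Omega> x *\<^sub>R (w x * g x))"
    using K(2,3) by (auto simp: fun_eq_iff indicator_def)
  finally show ?thesis by (simp add: set_integrable_def)
qed

lemma C0_infinityD:
  assumes "\<eta> \<in> C0_infinity \<Omega>"
  shows "continuous_on UNIV \<eta>" "\<And>b. b \<in> Basis \<Longrightarrow> continuous_on UNIV (partial_deriv b \<eta>)"
    and "\<And>x. \<eta> differentiable (at x)"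
    and "\<exists>K. compact K \<and> K \<subseteq> \<Omega> \<and> (\<forall>x. x \<notin> K \<longrightarrow> \<eta> x = 0 \<and> (\<forall>b. partial_deriv b \<eta> x = 0))"
proof -
  have smooth: "C_k k \<eta>" for k
    using assms by (simp add: C0_infinity_def smooth_def)
  show "continuous_on UNIV \<eta>" using smooth[of 0] by simp
  show "\<And>b. b \<in> Basis \<Longrightarrow> continuous_on UNIV (partial_deriv b \<eta>)"
    and "\<And>x. \<eta> differentiable (at x)"
    using smooth[of "Suc 0"] by auto
  define K where "K = closure {x. \<eta> x \<noteq> 0}"
  have K: "compact K" "K \<subseteq> \<Omega>"
    using assms by (simp_all add: C0_infinity_def K_def)
  have zero: "\<eta> x = 0" if "x \<notin> K" for x
    using that closure_subset[of "{x. \<eta> x \<noteq> 0}"] unfolding K_def by blast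
  have "partial_deriv b \<eta> x = 0" if x: "x \<notin> K" for x b
  proof -
    have "((\<lambda>_. 0) has_derivative (\<lambda>_. 0)) (at x)" by simp
    then have "(\<eta> has_derivative (\<lambda>_. 0)) (at x)"
    proof (rule has_derivative_transform_within_open)
      show "open (- K)" unfolding K_def by (intro open_Compl closed_closure)
      show "x \<in> - K" using x by blast
      show "0 = \<eta> y" if "y \<in> - K" for y using zero[of y] that by simp
    qed
    from frechet_derivative_at[OF this, symmetric] show ?thesis
      by (simp add: partial_deriv_def)
  qed
  with zero show "\<exists>K. compact K \<and> K \<subseteq> \<Omega> \<and> (\<forall>x. x \<notin> K \<longrightarrow> \<eta> x = 0 \<and> (\<forall>b. partial_deriv b \<eta> x = 0))"
    using K by (intro exI[of _ K]) blast
qed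

text \<open>Testing with the bumps of a box and passing to the limit by dominated convergence, with the
  integrable restriction of \<open>w\<close> to the closed box as majorant, shows that \<open>w\<close> has integral \<open>0\<close> over every
  box whose closure lies in \<open>\<Omega>\<close>. Countably many closed boxes cover \<open>\<Omega>\<close>.\<close>

lemma fundamental_lemma_calculus_of_variations:
  fixes w :: "'a::euclidean_space \<Rightarrow> complex"
  assumes \<Omega>: "open \<Omega>" and w: "locally_integrable \<Omega> w"
    and zero: "\<And>\<eta>. \<eta> \<in> C0_infinity \<Omega> \<Longrightarrow> set_lebesgue_integral lebesgue \<Omega> (\<lambda>x. w x * \<eta> x) = 0"
  shows "AE x in lebesgue. x \<in> \<Omega> \<longrightarrow> w x = 0"
proof -
  have box_zero: "set_lebesgue_integral lebesgue (box a b) w = 0" if ab: "cbox a b \<subseteq> \<Omega>" for a b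
  proof -
    have int: "integrable lebesgue (\<lambda>x. indicator (cbox a b) x *\<^sub>R w x)"
      using w ab compact_cbox unfolding locally_integrable_def set_integrable_def by blast
    define \<eta> where "\<eta> n = box_bump (real (Suc n)) a b" for n
    have \<eta>: "\<eta> n \<in> C0_infinity \<Omega>" for n
      unfolding \<eta>_def using ab by (intro box_bump_in_C0_infinity) auto
    have \<eta>_zero: "\<eta> n x = 0" if "x \<notin> box a b" for n x
      unfolding \<eta>_def using that by (intro box_bump_eq_0) auto
    have eq: "indicator \<Omega> x *\<^sub>R (w x * \<eta> n x) = (indicator (cbox a b) x *\<^sub>R w x) * \<eta> n x" for n x
      using \<eta>_zero[of x n] ab box_subset_cbox[of a b] by (auto simp: indicator_def)
    have "(\<lambda>n. \<integral>x. (indicator (cbox a b) x *\<^sub>R w x) * \<eta> n x \<partial>lebesgue)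
        \<longlonglongrightarrow> (\<integral>x. indicator (box a b) x *\<^sub>R w x \<partial>lebesgue)"
    proof (rule integral_dominated_convergence)
      show "integrable lebesgue (\<lambda>x. cmod (indicator (cbox a b) x *\<^sub>R w x))"
        using int by (rule integrable_norm)
      show "(\<lambda>x. (indicator (cbox a b) x *\<^sub>R w x) * \<eta> n x) \<in> borel_measurable lebesgue" for n
        using borel_measurable_continuous_onI[OF C0_infinityD(1)[OF \<eta>]]
        by (intro borel_measurable_times borel_measurable_integrable[OF int]) (simp add: measurable_completion)
      have "(\<lambda>x. indicator (box a b) x *\<^sub>R (indicator (cbox a b) x *\<^sub>R w x)) \<in> borel_measurable lebesgue"
        by (intro borel_measurable_scaleR borel_measurable_indicator borel_measurable_integrable[OF int]) simp
      also have "(\<lambda>x. indicator (box a b) x *\<^sub>R (indicator (cbox a b) x *\<^sub>R w x)) = (\<lambda>x. indicator (box a b) x *\<^sub>R w x)"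
        using box_subset_cbox[of a b] by (auto simp: indicator_def fun_eq_iff)
      finally show "(\<lambda>x. indicator (box a b) x *\<^sub>R w x) \<in> borel_measurable lebesgue" .
      show "AE x in lebesgue. (\<lambda>n. (indicator (cbox a b) x *\<^sub>R w x) * \<eta> n x) \<longlonglongrightarrow> indicator (box a b) x *\<^sub>R w x"
      proof (intro AE_I2)
        fix x
        have "(\<lambda>n. (indicator (cbox a b) x *\<^sub>R w x) * \<eta> n x)
            \<longlonglongrightarrow> (indicator (cbox a b) x *\<^sub>R w x) * indicator (box a b) x"
          unfolding \<eta>_def by (intro tendsto_intros box_bump_tendsto_indicator)
        then show "(\<lambda>n. (indicator (cbox a b) x *\<^sub>R w x) * \<eta> n x) \<longlonglongrightarrow> indicator (box a b) x *\<^sub>R w x"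
          using box_subset_cbox[of a b] by (auto simp: indicator_def split: if_splits)
      qed
      show "AE x in lebesgue. cmod ((indicator (cbox a b) x *\<^sub>R w x) * \<eta> n x) \<le> cmod (indicator (cbox a b) x *\<^sub>R w x)" for n
        unfolding norm_mult by (intro AE_I2 mult_left_le) (auto simp: \<eta>_def norm_box_bump_le_1)
    qed
    moreover have "(\<integral>x. (indicator (cbox a b) x *\<^sub>R w x) * \<eta> n x \<partial>lebesgue) = 0" for n
      using zero[OF \<eta>] by (simp add: set_lebesgue_integral_def eq)
    ultimately show ?thesis
      by (simp add: set_lebesgue_integral_def LIMSEQ_const_iff)
  qed
  have cbox: "AE x in lebesgue. x \<in> cbox a b \<longrightarrow> w x = 0" if ab: "cbox a b \<subseteq> \<Omega>" for a b
  proof -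
    have "set_integrable lebesgue (cbox a b) w"
      using w ab compact_cbox unfolding locally_integrable_def by blast
    then have "set_integrable lebesgue (box a b) w"
      by (rule set_integrable_subset) (auto simp: box_subset_cbox)
    then have "AE x in lebesgue. indicator (box a b) x *\<^sub>R w x = 0"
    proof (intro AE_zero_if_box_integrals_zero)
      fix c d :: 'a
      obtain e f where ef: "box c d \<inter> box a b = box e f"
        using box_Int_box by blast
      have "set_lebesgue_integral lebesgue (box c d) (\<lambda>x. indicator (box a b) x *\<^sub>R w x)
          = set_lebesgue_integral lebesgue (box c d \<inter> box a b) w"
        by (simp add: set_lebesgue_integral_def indicator_inter_arith)
      also have "\<dots> = 0"
      proof (cases "box e f = {}")
        case False
        then have "cbox e f \<subseteq> cbox a b"
          using ef by (metis Int_lower2 box_subset_cbox closed_cbox closure_box closure_minimal order_trans)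
        then show ?thesis unfolding ef using ab by (intro box_zero) auto
      qed (simp add: ef set_lebesgue_integral_def)
      finally show "set_lebesgue_integral lebesgue (box c d) (\<lambda>x. indicator (box a b) x *\<^sub>R w x) = 0" .
    qed (simp add: set_integrable_def)
    moreover have "AE x in lebesgue. x \<notin> cbox a b - box a b"
      using negligible_frontier_interval[of a b] AE_not_in by (simp add: negligible_iff_null_sets del: Diff_iff)
    ultimately show ?thesis
      by eventually_elim (auto simp: indicator_def)
  qed
  obtain D where D: "countable D" "D \<subseteq> Pow \<Omega>" "\<And>X. X \<in> D \<Longrightarrow> \<exists>a b. X = cbox a b" "\<Union>D = \<Omega>"
    using open_countable_Union_open_cbox[OF \<Omega>] by metis
  have "AE x in lebesgue. \<forall>X\<in>D. x \<in> X \<longrightarrow> w x = 0"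
    using D cbox by (subst AE_ball_countable) (auto, metis PowD subsetD)
  then show ?thesis
    by eventually_elim (use D(4) in auto)
qed

section \<open>Weak derivatives and inner products\<close>

lemma locally_integrable_lincomb:
  assumes "locally_integrable \<Omega> u" "locally_integrable \<Omega> w"
  shows "locally_integrable \<Omega> (\<lambda>x. c * u x + w x)"
  using assms unfolding locally_integrable_def
  by (auto intro!: set_integral_add set_integrable_mult_right)

text \<open>The chosen representative \<open>weak_partial\<close> carries no algebraic structure of its own; all its
  properties come from this uniqueness.\<close>

lemma weak_partial_unique:
  assumes \<Omega>: "open \<Omega>" and w: "is_weak_partial \<Omega> b u w" and w': "is_weak_partial \<Omega> b u w'"
  shows "AE x in lebesgue. x \<in> \<Omega> \<longrightarrow> w x = w' x"
proof -
  have loc: "locally_integrable \<Omega> w" "locally_integrable \<Omega> w'"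
    using w w' by (auto simp: is_weak_partial_def)
  have "AE x in lebesgue. x \<in> \<Omega> \<longrightarrow> (- 1) * w' x + w x = 0"
  proof (rule fundamental_lemma_calculus_of_variations[OF \<Omega> locally_integrable_lincomb[OF loc(2,1)]])
    fix \<eta> :: "'a \<Rightarrow> complex" assume \<eta>: "\<eta> \<in> C0_infinity \<Omega>"
    obtain K where K: "compact K" "K \<subseteq> \<Omega>" "\<And>x. x \<notin> K \<Longrightarrow> \<eta> x = 0"
      using C0_infinityD(4)[OF \<eta>] by blast
    have int: "set_integrable lebesgue \<Omega> (\<lambda>x. w x * \<eta> x)" "set_integrable lebesgue \<Omega> (\<lambda>x. w' x * \<eta> x)"
      using set_integrable_times_compactly_supported[OF _ C0_infinityD(1)[OF \<eta>] K] loc by blast+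
    have "set_lebesgue_integral lebesgue \<Omega> (\<lambda>x. (- 1 * w' x + w x) * \<eta> x)
        = set_lebesgue_integral lebesgue \<Omega> (\<lambda>x. w x * \<eta> x - w' x * \<eta> x)"
      by (simp add: algebra_simps)
    also have "\<dots> = set_lebesgue_integral lebesgue \<Omega> (\<lambda>x. w x * \<eta> x) - set_lebesgue_integral lebesgue \<Omega> (\<lambda>x. w' x * \<eta> x)"
      by (rule set_integral_diff[OF int])
    also have "\<dots> = 0"
    proof -
      have "set_lebesgue_integral lebesgue \<Omega> (\<lambda>x. u x * partial_deriv b \<eta> x) = - set_lebesgue_integral lebesgue \<Omega> (\<lambda>x. w x * \<eta> x)"
        "set_lebesgue_integral lebesgue \<Omega> (\<lambda>x. u x * partial_deriv b \<eta> x) = - set_lebesgue_integral lebesgue \<Omega> (\<lambda>x. w' x * \<eta> x)"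
        using w w' \<eta> unfolding is_weak_partial_def by blast+
      then show ?thesis by simp
    qed
    finally show "set_lebesgue_integral lebesgue \<Omega> (\<lambda>x. (- 1 * w' x + w x) * \<eta> x) = 0" .
  qed
  then show ?thesis by eventually_elim simp
qed

lemma is_weak_partial_lincomb:
  assumes b: "b \<in> Basis" and u: "is_weak_partial \<Omega> b u u'" and w: "is_weak_partial \<Omega> b w w'"
  shows "is_weak_partial \<Omega> b (\<lambda>x. c * u x + w x) (\<lambda>x. c * u' x + w' x)"
  unfolding is_weak_partial_def
proof (intro conjI ballI)
  have loc: "locally_integrable \<Omega> u" "locally_integrable \<Omega> w" "locally_integrable \<Omega> u'" "locally_integrable \<Omega> w'"
    using u w by (auto simp: is_weak_partial_def)
  then show "locally_integrable \<Omega> (\<lambda>x. c * u x + w x)" "locally_integrable \<Omega> (\<lambda>x. c * u' x + w' x)"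
    by (auto intro: locally_integrable_lincomb)
  fix \<eta> :: "'a \<Rightarrow> complex" assume \<eta>: "\<eta> \<in> C0_infinity \<Omega>"
  obtain K where K: "compact K" "K \<subseteq> \<Omega>" "\<And>x. x \<notin> K \<Longrightarrow> \<eta> x = 0" "\<And>x. x \<notin> K \<Longrightarrow> partial_deriv b \<eta> x = 0"
    using C0_infinityD(4)[OF \<eta>] by blast
  have int: "set_integrable lebesgue \<Omega> (\<lambda>x. f x * \<eta> x)" "set_integrable lebesgue \<Omega> (\<lambda>x. f x * partial_deriv b \<eta> x)"
    if "locally_integrable \<Omega> f" for f
    using set_integrable_times_compactly_supported[OF that C0_infinityD(1)[OF \<eta>] K(1,2,3)]
      set_integrable_times_compactly_supported[OF that C0_infinityD(2)[OF \<eta> b] K(1,2,4)] by auto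
  have split: "set_lebesgue_integral lebesgue \<Omega> (\<lambda>x. (c * f x + f' x) * g x) =
      c * set_lebesgue_integral lebesgue \<Omega> (\<lambda>x. f x * g x) + set_lebesgue_integral lebesgue \<Omega> (\<lambda>x. f' x * g x)"
    if "set_integrable lebesgue \<Omega> (\<lambda>x. f x * g x)" "set_integrable lebesgue \<Omega> (\<lambda>x. f' x * g x)" for f f' g
    using that by (simp add: distrib_right set_integral_add mult.assoc)
  have weak: "set_lebesgue_integral lebesgue \<Omega> (\<lambda>x. u x * partial_deriv b \<eta> x) = - set_lebesgue_integral lebesgue \<Omega> (\<lambda>x. u' x * \<eta> x)"
    "set_lebesgue_integral lebesgue \<Omega> (\<lambda>x. w x * partial_deriv b \<eta> x) = - set_lebesgue_integral lebesgue \<Omega> (\<lambda>x. w' x * \<eta> x)"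
    using u w \<eta> unfolding is_weak_partial_def by blast+
  show "set_lebesgue_integral lebesgue \<Omega> (\<lambda>x. (c * u x + w x) * partial_deriv b \<eta> x) =
      - set_lebesgue_integral lebesgue \<Omega> (\<lambda>x. (c * u' x + w' x) * \<eta> x)"
    by (simp only: split[OF int(1) int(1)] split[OF int(2) int(2)] loc weak) simp
qed

lemma L2_spaceD:
  assumes "u \<in> L2_space \<Omega>"
  shows "(\<lambda>x. indicator \<Omega> x *\<^sub>R u x) \<in> borel_measurable lebesgue"
    and "integrable lebesgue (\<lambda>x. (cmod (indicator \<Omega> x *\<^sub>R u x))\<^sup>2)"
proof -
  show "(\<lambda>x. indicator \<Omega> x *\<^sub>R u x) \<in> borel_measurable lebesgue"
    using assms by (simp add: L2_space_def set_borel_measurable_def)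
  have "(\<lambda>x. (cmod (indicator \<Omega> x *\<^sub>R u x))\<^sup>2) = (\<lambda>x. indicator \<Omega> x *\<^sub>R (cmod (u x))\<^sup>2)"
    by (auto simp: fun_eq_iff indicator_def)
  then show "integrable lebesgue (\<lambda>x. (cmod (indicator \<Omega> x *\<^sub>R u x))\<^sup>2)"
    using assms by (simp add: L2_space_def set_integrable_def)
qed

lemma L2_spaceI:
  assumes "(\<lambda>x. indicator \<Omega> x *\<^sub>R u x) \<in> borel_measurable lebesgue"
    and "integrable lebesgue (\<lambda>x. (cmod (indicator \<Omega> x *\<^sub>R u x))\<^sup>2)"
  shows "u \<in> L2_space \<Omega>"
proof -
  have "(\<lambda>x. (cmod (indicator \<Omega> x *\<^sub>R u x))\<^sup>2) = (\<lambda>x. indicator \<Omega> x *\<^sub>R (cmod (u x))\<^sup>2)"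
    by (auto simp: fun_eq_iff indicator_def)
  then show ?thesis
    using assms by (simp add: L2_space_def set_integrable_def set_borel_measurable_def)
qed

lemma L2_space_lincomb:
  assumes u: "u \<in> L2_space \<Omega>" and w: "w \<in> L2_space \<Omega>"
  shows "(\<lambda>x. c * u x + w x) \<in> L2_space \<Omega>"
proof (rule L2_spaceI)
  have eq: "(\<lambda>x. indicator \<Omega> x *\<^sub>R (c * u x + w x))
      = (\<lambda>x. c * (indicator \<Omega> x *\<^sub>R u x) + indicator \<Omega> x *\<^sub>R w x)"
    by (simp add: fun_eq_iff scaleR_add_right)
  show meas: "(\<lambda>x. indicator \<Omega> x *\<^sub>R (c * u x + w x)) \<in> borel_measurable lebesgue"
    unfolding eq
    by (intro borel_measurable_add borel_measurable_times borel_measurable_const L2_spaceD(1) u w)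
  have bound: "(cmod (c * a + b))\<^sup>2 \<le> 2 * (cmod c)\<^sup>2 * (cmod a)\<^sup>2 + 2 * (cmod b)\<^sup>2" for a b
  proof -
    have "(cmod (c * a + b))\<^sup>2 \<le> (cmod (c * a) + cmod b)\<^sup>2"
      by (intro power_mono norm_triangle_ineq) auto
    also have "\<dots> \<le> 2 * (cmod (c * a))\<^sup>2 + 2 * (cmod b)\<^sup>2"
      using sum_squares_bound[of "cmod (c * a)" "cmod b"] by (simp add: power2_sum)
    finally show ?thesis by (simp add: norm_mult power_mult_distrib)
  qed
  have "integrable lebesgue (\<lambda>x. 2 * (cmod c)\<^sup>2 * (cmod (indicator \<Omega> x *\<^sub>R u x))\<^sup>2
      + 2 * (cmod (indicator \<Omega> x *\<^sub>R w x))\<^sup>2)"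
    using L2_spaceD(2)[OF u] L2_spaceD(2)[OF w]
    by (intro Bochner_Integration.integrable_add integrable_mult_right)
  then show "integrable lebesgue (\<lambda>x. (cmod (indicator \<Omega> x *\<^sub>R (c * u x + w x)))\<^sup>2)"
  proof (rule Bochner_Integration.integrable_bound)
    show "(\<lambda>x. (cmod (indicator \<Omega> x *\<^sub>R (c * u x + w x)))\<^sup>2) \<in> borel_measurable lebesgue"
      by (intro borel_measurable_power measurable_compose[OF meas borel_measurable_norm])
    show "AE x in lebesgue. norm ((cmod (indicator \<Omega> x *\<^sub>R (c * u x + w x)))\<^sup>2) \<le>
        norm (2 * (cmod c)\<^sup>2 * (cmod (indicator \<Omega> x *\<^sub>R u x))\<^sup>2 + 2 * (cmod (indicator \<Omega> x *\<^sub>R w x))\<^sup>2)"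
      using bound by (intro AE_I2) (auto simp: indicator_def)
  qed
qed

lemma L2_space_cong_AE:
  fixes u w :: "'a::euclidean_space \<Rightarrow> complex"
  assumes u: "u \<in> L2_space \<Omega>" and ae: "AE x in lebesgue. x \<in> \<Omega> \<longrightarrow> u x = w x"
  shows "w \<in> L2_space \<Omega>"
proof -
  have ae': "AE x in lebesgue. indicator \<Omega> x *\<^sub>R u x = indicator \<Omega> x *\<^sub>R w x"
    using ae by eventually_elim (auto simp: indicator_def)
  show ?thesis
  proof (rule L2_spaceI)
    show meas: "(\<lambda>x. indicator \<Omega> x *\<^sub>R w x) \<in> borel_measurable lebesgue"
      using borel_measurable_AE[OF L2_spaceD(1)[OF u] ae'] .
    show "integrable lebesgue (\<lambda>x. (cmod (indicator \<Omega> x *\<^sub>R w x))\<^sup>2)"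
    proof (rule integrable_cong_AE_imp[OF L2_spaceD(2)[OF u]])
      show "(\<lambda>x. (cmod (indicator \<Omega> x *\<^sub>R w x))\<^sup>2) \<in> borel_measurable lebesgue"
        by (intro borel_measurable_power measurable_compose[OF meas borel_measurable_norm])
      show "AE x in lebesgue. (cmod (indicator \<Omega> x *\<^sub>R u x))\<^sup>2 = (cmod (indicator \<Omega> x *\<^sub>R w x))\<^sup>2"
        using ae' by eventually_elim (simp only:)
    qed
  qed
qed

lemma continuous_on_closure_in_L2_space:
  assumes \<Omega>: "open \<Omega>" "bounded \<Omega>" and u: "continuous_on (closure \<Omega>) u"
  shows "u \<in> L2_space \<Omega>"
proof -
  have cpt: "compact (closure \<Omega>)" using \<Omega>(2) by simp
  have int: "set_integrable lebesgue \<Omega> f" if f: "continuous_on (closure \<Omega>) f"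
    for f :: "'a \<Rightarrow> 'b::euclidean_space"
  proof (rule set_integrable_subset[OF _ _ closure_subset])
    have "integrable lborel (\<lambda>x. indicator (closure \<Omega>) x *\<^sub>R f x)"
      using borel_integrable_compact[OF cpt f] by simp
    then show "set_integrable lebesgue (closure \<Omega>) f"
      unfolding set_integrable_def by (subst integrable_completion) auto
  qed (use \<Omega> in auto)
  have "set_borel_measurable lebesgue \<Omega> u"
    using borel_measurable_integrable[OF int[OF u, unfolded set_integrable_def]]
    by (simp add: set_borel_measurable_def)
  moreover have "set_integrable lebesgue \<Omega> (\<lambda>x. (cmod (u x))\<^sup>2)"
    by (intro int continuous_intros u)
  ultimately show ?thesis by (simp add: L2_space_def)
qed

lemma L2_inner_integrable:
  assumes u: "u \<in> L2_space \<Omega>" and w: "w \<in> L2_space \<Omega>"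
  shows "set_integrable lebesgue \<Omega> (\<lambda>x. cnj (u x) * w x)"
  unfolding set_integrable_def
proof (rule Bochner_Integration.integrable_bound)
  show "integrable lebesgue (\<lambda>x. (cmod (indicator \<Omega> x *\<^sub>R u x))\<^sup>2 + (cmod (indicator \<Omega> x *\<^sub>R w x))\<^sup>2)"
    by (intro Bochner_Integration.integrable_add L2_spaceD(2) u w)
  have "(\<lambda>x. cnj (indicator \<Omega> x *\<^sub>R u x) * (indicator \<Omega> x *\<^sub>R w x)) \<in> borel_measurable lebesgue"
    using L2_spaceD(1)[OF u] L2_spaceD(1)[OF w]
    by (intro borel_measurable_times measurable_compose[OF _ borel_measurable_continuous_onI[of cnj]])
       (auto intro: continuous_intros)
  also have "(\<lambda>x. cnj (indicator \<Omega> x *\<^sub>R u x) * (indicator \<Omega> x *\<^sub>R w x)) = (\<lambda>x. indicator \<Omega> x *\<^sub>R (cnj (u x) * w x))"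
    by (auto simp: fun_eq_iff indicator_def)
  finally show "(\<lambda>x. indicator \<Omega> x *\<^sub>R (cnj (u x) * w x)) \<in> borel_measurable lebesgue" .
  show "AE x in lebesgue. norm (indicator \<Omega> x *\<^sub>R (cnj (u x) * w x))
      \<le> norm ((cmod (indicator \<Omega> x *\<^sub>R u x))\<^sup>2 + (cmod (indicator \<Omega> x *\<^sub>R w x))\<^sup>2)"
  proof (intro AE_I2)
    fix x
    have "cmod (u x) * cmod (w x) \<le> (cmod (u x))\<^sup>2 + (cmod (w x))\<^sup>2"
      using sum_squares_bound[of "cmod (u x)" "cmod (w x)"]
        mult_nonneg_nonneg[OF norm_ge_zero[of "u x"] norm_ge_zero[of "w x"]] by linarith
    then show "norm (indicator \<Omega> x *\<^sub>R (cnj (u x) * w x))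
      \<le> norm ((cmod (indicator \<Omega> x *\<^sub>R u x))\<^sup>2 + (cmod (indicator \<Omega> x *\<^sub>R w x))\<^sup>2)"
      by (auto simp: indicator_def norm_mult)
  qed
qed

lemma L2_inner_commute: "L2_inner \<Omega> u w = cnj (L2_inner \<Omega> w u)"
proof -
  have "cnj (L2_inner \<Omega> w u) = (\<integral>x. cnj (indicator \<Omega> x *\<^sub>R (cnj (w x) * u x)) \<partial>lebesgue)"
    unfolding L2_inner_def set_lebesgue_integral_def by (rule Bochner_Integration.integral_cnj[symmetric])
  then show ?thesis
    by (simp add: L2_inner_def set_lebesgue_integral_def mult.commute)
qed

lemma L2_inner_lincomb_right:
  assumes "\<phi> \<in> L2_space \<Omega>" "u \<in> L2_space \<Omega>" "w \<in> L2_space \<Omega>"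
  shows "L2_inner \<Omega> \<phi> (\<lambda>x. c * u x + w x) = c * L2_inner \<Omega> \<phi> u + L2_inner \<Omega> \<phi> w"
proof -
  have "L2_inner \<Omega> \<phi> (\<lambda>x. c * u x + w x)
      = set_lebesgue_integral lebesgue \<Omega> (\<lambda>x. c * (cnj (\<phi> x) * u x) + cnj (\<phi> x) * w x)"
    by (simp add: L2_inner_def algebra_simps)
  also have "\<dots> = c * L2_inner \<Omega> \<phi> u + L2_inner \<Omega> \<phi> w"
    using L2_inner_integrable[OF assms(1,2)] L2_inner_integrable[OF assms(1,3)]
    by (simp add: L2_inner_def set_integral_add)
  finally show ?thesis .
qed

lemma L2_inner_cong_AE_right:
  fixes u w w' :: "'a::euclidean_space \<Rightarrow> complex"
  assumes u: "u \<in> L2_space \<Omega>" and w: "w \<in> L2_space \<Omega>"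
    and ae: "AE x in lebesgue. x \<in> \<Omega> \<longrightarrow> w x = w' x"
  shows "L2_inner \<Omega> u w = L2_inner \<Omega> u w'"
  unfolding L2_inner_def set_lebesgue_integral_def
proof (rule integral_cong_AE)
  show "(\<lambda>x. indicator \<Omega> x *\<^sub>R (cnj (u x) * w x)) \<in> borel_measurable lebesgue"
    "(\<lambda>x. indicator \<Omega> x *\<^sub>R (cnj (u x) * w' x)) \<in> borel_measurable lebesgue"
    using L2_inner_integrable[OF u w] L2_inner_integrable[OF u L2_space_cong_AE[OF w ae]]
    by (auto simp: set_integrable_def)
  show "AE x in lebesgue. indicator \<Omega> x *\<^sub>R (cnj (u x) * w x) = indicator \<Omega> x *\<^sub>R (cnj (u x) * w' x)"
    using ae by eventually_elim (auto simp: indicator_def)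
qed

lemma L2_inner_self: "L2_inner \<Omega> u u = complex_of_real ((L2_norm \<Omega> u)\<^sup>2)"
proof -
  have "L2_inner \<Omega> u u = complex_of_real (set_lebesgue_integral lebesgue \<Omega> (\<lambda>x. (cmod (u x))\<^sup>2))"
    unfolding L2_inner_def set_lebesgue_integral_def
    by (subst integral_complex_of_real[symmetric])
       (auto intro!: Bochner_Integration.integral_cong simp: complex_norm_square indicator_def mult.commute simp del: of_real_power)
  moreover have "0 \<le> set_lebesgue_integral lebesgue \<Omega> (\<lambda>x. (cmod (u x))\<^sup>2)"
    unfolding set_lebesgue_integral_def by (intro integral_nonneg_AE) auto
  ultimately show ?thesis by (simp add: L2_norm_def)
qed

text \<open>Continuity upgrades vanishing almost everywhere in the open set \<open>\<Omega>\<close> to vanishing everywhere in \<open>\<Omega>\<close>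
  and then on its closure. On the complement of the closure elements of \<open>C_closure \<Omega>\<close> vanish by convention.\<close>

lemma L2_inner_definite:
  assumes \<Omega>: "open \<Omega>" "bounded \<Omega>" and u: "u \<in> C_closure \<Omega>" and zero: "L2_inner \<Omega> u u = 0"
  shows "u = (\<lambda>_. 0)"
proof -
  have cont: "continuous_on (closure \<Omega>) u" and out: "\<And>x. x \<notin> closure \<Omega> \<Longrightarrow> u x = 0"
    using u by (auto simp: C_closure_def)
  have "integrable lebesgue (\<lambda>x. indicator \<Omega> x *\<^sub>R (cmod (u x))\<^sup>2)"
    using continuous_on_closure_in_L2_space[OF \<Omega> cont] by (simp add: L2_space_def set_integrable_def)
  moreover have "(\<integral>x. indicator \<Omega> x *\<^sub>R (cmod (u x))\<^sup>2 \<partial>lebesgue) = 0"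
    using zero unfolding L2_inner_self L2_norm_def
    by (simp add: set_lebesgue_integral_def integral_nonneg_AE)
  ultimately have "AE x in lebesgue. indicator \<Omega> x *\<^sub>R (cmod (u x))\<^sup>2 = 0"
    by (subst (asm) integral_nonneg_eq_0_iff_AE) auto
  then have "AE x in lebesgue. x \<notin> \<Omega> \<inter> {x. u x \<noteq> 0}"
    by eventually_elim (auto simp: indicator_def)
  moreover have "open (\<Omega> \<inter> {x. u x \<noteq> 0})"
  proof -
    have "open (\<Omega> \<inter> u -` (- {0}))"
      using cont closure_subset continuous_on_subset
      by (intro continuous_open_preimage \<Omega>) blast+
    then show ?thesis by (simp add: vimage_def)
  qed
  ultimately have "\<Omega> \<inter> {x. u x \<noteq> 0} = {}"
    using open_not_negligible AE_iff_null_sets[of "\<Omega> \<inter> {x. u x \<noteq> 0}" lebesgue]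
    by (metis (no_types, lifting) borel_open negligible_iff_null_sets sets_completionI_sets sets_lborel)
  then have "u x = 0" if "x \<in> closure \<Omega>" for x
    using continuous_constant_on_closure[OF cont _ that, of 0] by blast
  with out show ?thesis by blast
qed

lemma weak_partial_H1:
  assumes \<Omega>: "open \<Omega>" and u: "u \<in> H1_space \<Omega>" and b: "b \<in> Basis"
  shows "is_weak_partial \<Omega> b u (weak_partial \<Omega> b u)" "weak_partial \<Omega> b u \<in> L2_space \<Omega>"
proof -
  obtain w where w: "w \<in> L2_space \<Omega>" "is_weak_partial \<Omega> b u w"
    using u b by (auto simp: H1_space_def)
  then show *: "is_weak_partial \<Omega> b u (weak_partial \<Omega> b u)"
    unfolding weak_partial_def by (metis someI)
  show "weak_partial \<Omega> b u \<in> L2_space \<Omega>"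
    by (rule L2_space_cong_AE[OF w(1) weak_partial_unique[OF \<Omega> w(2) *]])
qed

lemma H1_space_lincomb:
  assumes u: "u \<in> H1_space \<Omega>" and w: "w \<in> H1_space \<Omega>"
  shows "(\<lambda>x. c * u x + w x) \<in> H1_space \<Omega>"
  unfolding H1_space_def
proof (intro CollectI conjI ballI)
  show "(\<lambda>x. c * u x + w x) \<in> L2_space \<Omega>"
    using u w by (intro L2_space_lincomb) (auto simp: H1_space_def)
  fix b :: 'a assume b: "b \<in> Basis"
  obtain u' w' where "u' \<in> L2_space \<Omega>" "is_weak_partial \<Omega> b u u'" "w' \<in> L2_space \<Omega>" "is_weak_partial \<Omega> b w w'"
    using u w b unfolding H1_space_def by blast
  then show "\<exists>z\<in>L2_space \<Omega>. is_weak_partial \<Omega> b (\<lambda>x. c * u x + w x) z"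
    using L2_space_lincomb is_weak_partial_lincomb[OF b] by blast
qed

lemma grad_inner_commute: "grad_inner \<Omega> u w = cnj (grad_inner \<Omega> w u)"
  unfolding grad_inner_def cnj_sum by (intro sum.cong refl L2_inner_commute)

text \<open>Weak derivatives are linear up to null sets, which the integrals do not see.\<close>

lemma grad_inner_lincomb_right:
  assumes \<Omega>: "open \<Omega>" and \<phi>: "\<phi> \<in> H1_space \<Omega>" and u: "u \<in> H1_space \<Omega>" and w: "w \<in> H1_space \<Omega>"
  shows "grad_inner \<Omega> \<phi> (\<lambda>x. c * u x + w x) = c * grad_inner \<Omega> \<phi> u + grad_inner \<Omega> \<phi> w"
proof -
  have "L2_inner \<Omega> (weak_partial \<Omega> b \<phi>) (weak_partial \<Omega> b (\<lambda>x. c * u x + w x)) =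
      c * L2_inner \<Omega> (weak_partial \<Omega> b \<phi>) (weak_partial \<Omega> b u) + L2_inner \<Omega> (weak_partial \<Omega> b \<phi>) (weak_partial \<Omega> b w)"
    if b: "b \<in> Basis" for b
  proof -
    note wp = weak_partial_H1[OF \<Omega> _ b]
    have "L2_inner \<Omega> (weak_partial \<Omega> b \<phi>) (weak_partial \<Omega> b (\<lambda>x. c * u x + w x)) =
        L2_inner \<Omega> (weak_partial \<Omega> b \<phi>) (\<lambda>x. c * weak_partial \<Omega> b u x + weak_partial \<Omega> b w x)"
      using weak_partial_unique[OF \<Omega> wp(1)[OF H1_space_lincomb[OF u w]]
          is_weak_partial_lincomb[OF b wp(1)[OF u] wp(1)[OF w]]]
      by (intro L2_inner_cong_AE_right wp(2) H1_space_lincomb \<phi> u w)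
    then show ?thesis
      by (simp add: L2_inner_lincomb_right wp(2) \<phi> u w)
  qed
  then show ?thesis
    by (simp add: grad_inner_def sum.distrib sum_distrib_left)
qed

section \<open>Orthonormal bases of Galerkin spaces\<close>

locale galerkin_space =
  fixes \<Omega> :: "'a::euclidean_space set" and S :: "('a \<Rightarrow> complex) set"
  assumes open_domain: "open \<Omega>" and bounded_domain: "bounded \<Omega>"
    and subspace_S: "cfun.subspace S"
    and S_subset: "S \<subseteq> C_closure \<Omega> \<inter> H10_space \<Omega>"
    and finite_span: "\<exists>B. finite B \<and> cfun.span B = S"
begin

lemma S_lincomb: "u \<in> S \<Longrightarrow> w \<in> S \<Longrightarrow> (\<lambda>x. c * u x + w x) \<in> S"
  using cfun.subspace_add[OF subspace_S cfun.subspace_scale[OF subspace_S]]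
  by (simp add: plus_fun_def)

lemma S_sum:
  fixes n :: nat
  assumes "e ` {..<n} \<subseteq> S"
  shows "(\<lambda>x. \<Sum>i<n. c i * e i x) \<in> S"
  using assms
proof (induction n)
  case 0
  then show ?case using cfun.subspace_0[OF subspace_S] by (simp add: zero_fun_def)
next
  case (Suc n)
  then have "e n \<in> S" "e ` {..<n} \<subseteq> S" by auto
  then show ?case
    using S_lincomb[of "e n" "\<lambda>x. \<Sum>i<n. c i * e i x" "c n"] Suc.IH by (simp add: add.commute)
qed

text \<open>Stated for functionals that are linear on \<open>S\<close> only, since the inner products are linear only
  where their integrands are integrable.\<close>

lemma linear_functional_sum:
  fixes n :: nat
  assumes lin: "\<And>c u w. u \<in> S \<Longrightarrow> w \<in> S \<Longrightarrow> l (\<lambda>x. c * u x + w x) = c * l u + l w"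
    and e: "e ` {..<n} \<subseteq> S"
  shows "l (\<lambda>x. \<Sum>i<n. c i * e i x) = (\<Sum>i<n. c i * (l (e i) :: complex))"
  using e
proof (induction n)
  case 0
  have "(\<lambda>_. 0) \<in> S" using cfun.subspace_0[OF subspace_S] by (simp add: zero_fun_def)
  from lin[OF this this, of 1] show ?case by simp
next
  case (Suc n)
  then have e: "e n \<in> S" "e ` {..<n} \<subseteq> S" by auto
  then have "l (\<lambda>x. c n * e n x + (\<Sum>i<n. c i * e i x)) = c n * l (e n) + l (\<lambda>x. \<Sum>i<n. c i * e i x)"
    by (intro lin S_sum)
  then show ?case using Suc.IH[OF e(2)] by (simp add: add.commute)
qed

lemma S_continuous: "u \<in> S \<Longrightarrow> continuous_on (closure \<Omega>) u"
  using S_subset by (auto simp: C_closure_def)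

lemma continuous_L2: "continuous_on (closure \<Omega>) u \<Longrightarrow> u \<in> L2_space \<Omega>"
  by (rule continuous_on_closure_in_L2_space[OF open_domain bounded_domain])

lemma S_L2: "u \<in> S \<Longrightarrow> u \<in> L2_space \<Omega>"
  by (intro continuous_L2 S_continuous)

lemma S_H1: "u \<in> S \<Longrightarrow> u \<in> H1_space \<Omega>"
  using S_subset by (auto simp: H10_space_def)

lemma S_definite: "u \<in> S \<Longrightarrow> L2_inner \<Omega> u u = 0 \<Longrightarrow> u = (\<lambda>_. 0)"
  using S_subset by (intro L2_inner_definite[OF open_domain bounded_domain]) auto

lemma L2_inner_sum_right:
  fixes n :: nat
  assumes "\<phi> \<in> L2_space \<Omega>" "e ` {..<n} \<subseteq> S"
  shows "L2_inner \<Omega> \<phi> (\<lambda>x. \<Sum>i<n. c i * e i x) = (\<Sum>i<n. c i * L2_inner \<Omega> \<phi> (e i))"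
  using assms by (intro linear_functional_sum) (auto intro: L2_inner_lincomb_right S_L2)

text \<open>Gram-Schmidt orthonormalisation, one spanning vector at a time. A vector whose component
  orthogonal to the preceding system is \<open>0\<close> contributes nothing.\<close>

lemma orthonormal_system_spanning:
  assumes "finite B" "B \<subseteq> S"
  shows "\<exists>(n :: nat) e. e ` {..<n} \<subseteq> S \<and> (\<forall>i<n. \<forall>j<n. L2_inner \<Omega> (e i) (e j) = (if i = j then 1 else 0)) \<and>
    (\<forall>u\<in>cfun.span B. \<exists>c. u = (\<lambda>x. \<Sum>i<n. c i * e i x))"
  using assms
proof (induction B rule: finite_induct)
  case empty
  then show ?case by (intro exI[of _ 0]) (auto simp: zero_fun_def)
next
  case (insert b B)
  then have "B \<subseteq> S" by simp
  from insert.IH[OF this] obtain n :: nat and e :: "nat \<Rightarrow> 'a \<Rightarrow> complex" where e: "e ` {..<n} \<subseteq> S"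
    and on: "\<And>i j. i < n \<Longrightarrow> j < n \<Longrightarrow> L2_inner \<Omega> (e i) (e j) = (if i = j then 1 else 0)"
    and span: "\<And>u. u \<in> cfun.span B \<Longrightarrow> \<exists>c. u = (\<lambda>x. \<Sum>i<n. c i * e i x)"
    by blast
  have b: "b \<in> S" using insert by simp
  have eS: "e i \<in> S" if "i < n" for i using e that by auto
  define p where "p i = L2_inner \<Omega> (e i) b" for i
  \<comment> \<open>The component of \<open>b\<close> orthogonal to the system constructed so far.\<close>
  define b' where "b' = (\<lambda>x. (- 1) * (\<Sum>i<n. p i * e i x) + b x)"
  have b': "b' \<in> S" unfolding b'_def by (intro S_lincomb S_sum e b)
  have span': "\<exists>k c. u = (\<lambda>x. k * b' x + (\<Sum>i<n. c i * e i x))" if u: "u \<in> cfun.span (insert b B)" for u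
  proof -
    obtain k where "u - (\<lambda>x. k * b x) \<in> cfun.span B"
      using u by (auto simp: cfun.span_breakdown_eq)
    then obtain c where c: "u - (\<lambda>x. k * b x) = (\<lambda>x. \<Sum>i<n. c i * e i x)"
      using span by blast
    have "u x = k * b' x + (\<Sum>i<n. (c i + k * p i) * e i x)" for x
      using fun_cong[OF c, of x]
      by (simp add: b'_def algebra_simps sum.distrib sum_distrib_left)
    then show ?thesis by (intro exI[of _ k] exI[of _ "\<lambda>i. c i + k * p i"]) (rule ext)
  qed
  have orth: "L2_inner \<Omega> (e i) b' = 0" if "i < n" for i
  proof -
    have "L2_inner \<Omega> (e i) b' = - 1 * (\<Sum>j<n. p j * L2_inner \<Omega> (e i) (e j)) + p i"
      unfolding b'_def p_def[of i] using that
      by (subst L2_inner_lincomb_right) (auto intro!: S_L2 S_sum e eS b simp: L2_inner_sum_right[OF S_L2[OF eS] e])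
    also have "(\<Sum>j<n. p j * L2_inner \<Omega> (e i) (e j)) = p i"
      using that by (simp add: on if_distrib[of "\<lambda>w. _ * w"] cong: if_cong)
    finally show ?thesis by simp
  qed
  show ?case
  proof (cases "L2_inner \<Omega> b' b' = 0")
    case True
    then have "b' = (\<lambda>_. 0)" using b' by (intro S_definite)
    then show ?thesis using span' e on by (intro exI[of _ n] exI[of _ e]) auto
  next
    case False
    define r where "r = L2_norm \<Omega> b'"
    have r: "r \<noteq> 0" and rr: "L2_inner \<Omega> b' b' = complex_of_real r * complex_of_real r"
      using False L2_inner_self[of \<Omega> b'] by (auto simp: r_def power2_eq_square)
    define f where "f = (\<lambda>x. (1 / complex_of_real r) * b' x + 0)"
    have zero: "(\<lambda>_. 0) \<in> S" using cfun.subspace_0[OF subspace_S] by (simp add: zero_fun_def)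
    have f: "f \<in> S" unfolding f_def by (intro S_lincomb b' zero)
    have scale: "L2_inner \<Omega> \<phi> f = (1 / complex_of_real r) * L2_inner \<Omega> \<phi> b'" if "\<phi> \<in> S" for \<phi>
    proof -
      have "L2_inner \<Omega> \<phi> (\<lambda>_. 0) = 0" by (simp add: L2_inner_def set_lebesgue_integral_def)
      then show ?thesis
        unfolding f_def using that b' zero by (subst L2_inner_lincomb_right) (auto intro: S_L2)
    qed
    have ef: "L2_inner \<Omega> (e i) f = 0" "L2_inner \<Omega> f (e i) = 0" if "i < n" for i
      using that scale[OF eS] orth L2_inner_commute[of \<Omega> f "e i"] by auto
    have "L2_inner \<Omega> b' f = complex_of_real r"
      using scale[OF b'] rr r by simp
    then have ff: "L2_inner \<Omega> f f = 1"
      using scale[OF f] L2_inner_commute[of \<Omega> f b'] r by simp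
    define e' where "e' = e(n := f)"
    have e'_lt: "e' i = e i" if "i < n" for i using that by (simp add: e'_def)
    have e'_n: "e' n = f" by (simp add: e'_def)
    show ?thesis
    proof (intro exI[of _ "Suc n"] exI[of _ e'] conjI allI impI ballI)
      show "e' ` {..<Suc n} \<subseteq> S" using eS f by (auto simp: less_Suc_eq e'_lt e'_n)
    next
      fix i j assume "i < Suc n" "j < Suc n"
      then show "L2_inner \<Omega> (e' i) (e' j) = (if i = j then 1 else 0)"
        using on ef ff by (auto simp: less_Suc_eq e'_lt e'_n)
    next
      fix u assume "u \<in> cfun.span (insert b B)"
      then obtain k c where u: "u = (\<lambda>x. k * b' x + (\<Sum>i<n. c i * e i x))" using span' by blast
      have "u = (\<lambda>x. \<Sum>i<Suc n. (c(n := k * complex_of_real r)) i * e' i x)"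
        using r by (simp add: u e'_lt e'_n f_def fun_eq_iff)
      then show "\<exists>c. u = (\<lambda>x. \<Sum>i<Suc n. c i * e' i x)" by blast
    qed
  qed
qed

definition orthonormal_basis :: "nat \<Rightarrow> (nat \<Rightarrow> 'a \<Rightarrow> complex) \<Rightarrow> bool" where
  "orthonormal_basis n e \<longleftrightarrow> e ` {..<n} \<subseteq> S \<and>
     (\<forall>i<n. \<forall>j<n. L2_inner \<Omega> (e i) (e j) = (if i = j then 1 else 0)) \<and>
     (\<forall>u\<in>S. u = (\<lambda>x. \<Sum>i<n. L2_inner \<Omega> (e i) u * e i x))"

lemma orthonormal_basisD:
  assumes "orthonormal_basis n e"
  shows "e ` {..<n} \<subseteq> S" "\<And>i. i < n \<Longrightarrow> e i \<in> S"
    and "\<And>i j. i < n \<Longrightarrow> j < n \<Longrightarrow> L2_inner \<Omega> (e i) (e j) = (if i = j then 1 else 0)"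
    and "\<And>u. u \<in> S \<Longrightarrow> u = (\<lambda>x. \<Sum>i<n. L2_inner \<Omega> (e i) u * e i x)"
  using assms unfolding orthonormal_basis_def by blast+

lemma orthonormal_basis_exists: "\<exists>n e. orthonormal_basis n e"
proof -
  obtain B where B: "finite B" "cfun.span B = S" using finite_span by blast
  then have "B \<subseteq> S" using cfun.span_superset by blast
  from orthonormal_system_spanning[OF B(1) this] obtain n and e :: "nat \<Rightarrow> 'a \<Rightarrow> complex"
    where e: "e ` {..<n} \<subseteq> S"
      and on: "\<And>i j. i < n \<Longrightarrow> j < n \<Longrightarrow> L2_inner \<Omega> (e i) (e j) = (if i = j then 1 else 0)"
      and span: "\<And>u. u \<in> S \<Longrightarrow> \<exists>c. u = (\<lambda>x. \<Sum>i<n. c i * e i x)"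
    unfolding B(2) by blast
  have "u = (\<lambda>x. \<Sum>i<n. L2_inner \<Omega> (e i) u * e i x)" if "u \<in> S" for u
  proof -
    from span[OF that] obtain c where c: "u = (\<lambda>x. \<Sum>i<n. c i * e i x)" by blast
    have "L2_inner \<Omega> (e j) u = c j" if "j < n" for j
    proof -
      have ej: "e j \<in> S" using e that by auto
      then show ?thesis
        unfolding c L2_inner_sum_right[OF S_L2[OF ej] e]
        using that by (simp add: on if_distrib[of "\<lambda>w. _ * w"] cong: if_cong)
    qed
    then show ?thesis by (subst c) simp
  qed
  with e on show ?thesis unfolding orthonormal_basis_def by blast
qed

end

section \<open>The Hartree form\<close>

lemma C0_infinity_bounded:
  assumes "\<eta> \<in> C0_infinity U"
  shows "\<exists>M. \<forall>x. norm (\<eta> x) \<le> M"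
proof -
  obtain K where K: "compact K" "\<And>x. x \<notin> K \<Longrightarrow> \<eta> x = 0"
    using C0_infinityD(4)[OF assms] by blast
  have "bounded (\<eta> ` K)"
    using C0_infinityD(1)[OF assms] K(1)
    by (meson compact_continuous_image compact_imp_bounded continuous_on_subset subset_UNIV)
  then obtain M where "0 < M" "\<And>x. x \<in> K \<Longrightarrow> norm (\<eta> x) \<le> M"
    unfolding bounded_pos by auto
  then have "norm (\<eta> x) \<le> M" for x using K(2)[of x] by (cases "x \<in> K") auto
  then show ?thesis by blast
qed

locale hartree_galerkin = galerkin_space \<Omega> S
  for \<Omega> :: "'a::euclidean_space set" and S :: "('a \<Rightarrow> complex) set" +
  fixes v lam V :: "'a \<Rightarrow> real"
  assumes v: "v \<in> C0_infinity \<Omega>" and lam: "lam \<in> C0_infinity \<Omega>" and V: "V \<in> C0_infinity UNIV"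
begin

text \<open>The convolution of \<open>V\<close> with \<open>cnj p * q\<close>. Polarising \<open>|u|\<^sup>2\<close> in this way exposes the
  nonlinearity as the diagonal of a form that is linear or antilinear in each argument.\<close>

definition interaction :: "('a \<Rightarrow> complex) \<Rightarrow> ('a \<Rightarrow> complex) \<Rightarrow> 'a \<Rightarrow> complex" where
  "interaction p q x = L2_inner \<Omega> p (\<lambda>y. complex_of_real (V (x - y)) * q y)"

lemma continuous_V_shift: "continuous_on A (\<lambda>y. complex_of_real (V (x - y)))"
  by (intro continuous_intros continuous_on_compose2[OF C0_infinityD(1)[OF V]]) auto

lemma interaction_lincomb_right:
  assumes "p \<in> S" "q \<in> S" "r \<in> S"
  shows "interaction p (\<lambda>y. c * q y + r y) x = c * interaction p q x + interaction p r x"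
proof -
  have "interaction p (\<lambda>y. c * q y + r y) x
      = L2_inner \<Omega> p (\<lambda>y. c * (complex_of_real (V (x - y)) * q y) + complex_of_real (V (x - y)) * r y)"
    by (simp add: interaction_def algebra_simps)
  also have "\<dots> = c * interaction p q x + interaction p r x"
    unfolding interaction_def using assms
    by (intro L2_inner_lincomb_right continuous_L2 S_L2 continuous_on_mult continuous_V_shift S_continuous)
  finally show ?thesis .
qed

lemma interaction_commute: "interaction p q x = cnj (interaction q p x)"
  unfolding interaction_def by (subst L2_inner_commute) (simp add: L2_inner_def mult_ac)

lemma interaction_lincomb_left:
  assumes "p \<in> S" "q \<in> S" "r \<in> S"
  shows "interaction (\<lambda>y. c * p y + r y) q x = cnj c * interaction p q x + interaction r q x"
  by (subst (1 2 3) interaction_commute) (simp add: interaction_lincomb_right assms)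

text \<open>Dominated convergence, with \<open>M * |p| * |q|\<close> on \<open>\<Omega>\<close> as majorant for a bound \<open>M\<close> of \<open>|V|\<close>.\<close>

lemma continuous_interaction:
  assumes "p \<in> S" "q \<in> S"
  shows "continuous_on A (interaction p q)"
proof -
  obtain M where M: "\<And>x. \<bar>V x\<bar> \<le> M" using C0_infinity_bounded[OF V] by auto
  have int: "integrable lebesgue (\<lambda>y. indicator \<Omega> y *\<^sub>R (cnj (p y) * q y))"
    using L2_inner_integrable[OF S_L2 S_L2] assms by (simp add: set_integrable_def)
  have "continuous_on UNIV (interaction p q)"
    unfolding continuous_on_sequentially
  proof (intro allI ballI impI)
    fix xs and x :: 'a
    assume xs: "(\<forall>n. xs n \<in> UNIV) \<and> xs \<longlonglongrightarrow> x"
    let ?f = "\<lambda>x y. complex_of_real (V (x - y)) * (indicator \<Omega> y *\<^sub>R (cnj (p y) * q y))"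
    have meas: "?f x \<in> borel_measurable lebesgue" for x
      using borel_measurable_continuous_onI[OF continuous_V_shift]
      by (intro borel_measurable_times borel_measurable_integrable[OF int]) (simp add: measurable_completion)
    have "(\<lambda>n. \<integral>y. ?f (xs n) y \<partial>lebesgue) \<longlonglongrightarrow> (\<integral>y. ?f x y \<partial>lebesgue)"
    proof (rule integral_dominated_convergence[where w = "\<lambda>y. M * cmod (indicator \<Omega> y *\<^sub>R (cnj (p y) * q y))"])
      show "integrable lebesgue (\<lambda>y. M * cmod (indicator \<Omega> y *\<^sub>R (cnj (p y) * q y)))"
        by (intro integrable_mult_right integrable_norm int)
      have "(\<lambda>n. V (xs n - y)) \<longlonglongrightarrow> V (x - y)" for y
        using xs by (intro continuous_on_tendsto_compose[OF C0_infinityD(1)[OF V]] tendsto_intros) auto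
      then show "AE y in lebesgue. (\<lambda>n. ?f (xs n) y) \<longlonglongrightarrow> ?f x y"
        by (intro AE_I2 tendsto_intros)
      show "AE y in lebesgue. norm (?f (xs n) y) \<le> M * cmod (indicator \<Omega> y *\<^sub>R (cnj (p y) * q y))" for n
        unfolding norm_mult[of "complex_of_real _"] norm_of_real
        by (intro AE_I2 mult_right_mono M norm_ge_zero)
    qed (rule meas)+
    moreover have "(\<integral>y. ?f x y \<partial>lebesgue) = interaction p q x" for x
      by (simp add: interaction_def L2_inner_def set_lebesgue_integral_def mult_ac scaleR_conv_of_real)
    ultimately show "(interaction p q \<circ> xs) \<longlonglongrightarrow> interaction p q x"
      by (simp add: o_def)
  qed
  then show ?thesis by (rule continuous_on_subset) simp
qed

lemma continuous_coefficients: "continuous_on A (\<lambda>x. complex_of_real (v x))"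
  "continuous_on A (\<lambda>x. complex_of_real (lam x))"
  using C0_infinityD(1)[OF v] C0_infinityD(1)[OF lam]
  by (auto intro: continuous_on_of_real continuous_on_subset)

definition quartic :: "('a \<Rightarrow> complex) \<Rightarrow> ('a \<Rightarrow> complex) \<Rightarrow> ('a \<Rightarrow> complex) \<Rightarrow> ('a \<Rightarrow> complex) \<Rightarrow> complex" where
  "quartic \<phi> p q u = L2_inner \<Omega> \<phi> (\<lambda>x. complex_of_real (lam x) * interaction p q x * u x)"

lemma quartic_L2:
  assumes "p \<in> S" "q \<in> S" "u \<in> S"
  shows "(\<lambda>x. complex_of_real (lam x) * interaction p q x * u x) \<in> L2_space \<Omega>"
  using assms by (intro continuous_L2 continuous_on_mult continuous_coefficients continuous_interaction S_continuous)

lemma quartic_lincomb: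
  assumes "\<phi> \<in> S" "p \<in> S" "q \<in> S" "u \<in> S" "w \<in> S"
  shows "quartic \<phi> p q (\<lambda>x. c * u x + w x) = c * quartic \<phi> p q u + quartic \<phi> p q w"
    and "quartic \<phi> p (\<lambda>x. c * u x + w x) q = c * quartic \<phi> p u q + quartic \<phi> p w q"
    and "quartic \<phi> (\<lambda>x. c * u x + w x) p q = cnj c * quartic \<phi> u p q + quartic \<phi> w p q"
proof -
  have expand: "L2_inner \<Omega> \<phi> f = c' * L2_inner \<Omega> \<phi> g + L2_inner \<Omega> \<phi> h"
    if "\<And>x. f x = c' * g x + h x" "g \<in> L2_space \<Omega>" "h \<in> L2_space \<Omega>" for f g h c'
    unfolding L2_inner_lincomb_right[OF S_L2[OF assms(1)] that(2,3), symmetric]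
    by (rule arg_cong[where f = "L2_inner \<Omega> \<phi>"]) (rule ext, rule that(1))
  show "quartic \<phi> p q (\<lambda>x. c * u x + w x) = c * quartic \<phi> p q u + quartic \<phi> p q w"
    unfolding quartic_def 
    by (rule expand; (intro quartic_L2 assms)?) (simp add: algebra_simps)
  show "quartic \<phi> p (\<lambda>x. c * u x + w x) q = c * quartic \<phi> p u q + quartic \<phi> p w q"
    unfolding quartic_def
    by (rule expand; (intro quartic_L2 assms)?)
       (simp only: interaction_lincomb_right[OF assms(2,4,5)], simp add: algebra_simps)
  show "quartic \<phi> (\<lambda>x. c * u x + w x) p q = cnj c * quartic \<phi> u p q + quartic \<phi> w p q"
    unfolding quartic_def
    by (rule expand; (intro quartic_L2 assms)?)
       (simp only: interaction_lincomb_left[OF assms(4,2,5)], simp add: algebra_simps)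
qed

lemma g_conv_eq_interaction:
  "g_conv \<Omega> V (\<lambda>y. complex_of_real ((cmod (u y))\<^sup>2)) x = interaction u u x"
  unfolding g_conv_def interaction_def L2_inner_def
  by (simp add: complex_norm_square mult_ac del: of_real_power)

lemma f_nonlin_eq: "f_nonlin \<Omega> lam V u = (\<lambda>x. complex_of_real (lam x) * interaction u u x * u x)"
  by (simp add: f_nonlin_def g_conv_eq_interaction fun_eq_iff del: of_real_power)

definition hartree_form :: "('a \<Rightarrow> complex) \<Rightarrow> ('a \<Rightarrow> complex) \<Rightarrow> complex" where
  "hartree_form \<phi> u = grad_inner \<Omega> \<phi> u + L2_inner \<Omega> \<phi> (\<lambda>x. complex_of_real (v x) * u x)
     + L2_inner \<Omega> \<phi> (f_nonlin \<Omega> lam V u)"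

lemma potential_L2: "u \<in> S \<Longrightarrow> (\<lambda>x. complex_of_real (v x) * u x) \<in> L2_space \<Omega>"
  by (intro continuous_L2 continuous_on_mult continuous_coefficients S_continuous)

lemma hartree_form_lincomb_left:
  assumes "\<phi> \<in> S" "\<phi>' \<in> S" "u \<in> S"
  shows "hartree_form (\<lambda>x. c * \<phi> x + \<phi>' x) u = cnj c * hartree_form \<phi> u + hartree_form \<phi>' u"
proof -
  have L2: "L2_inner \<Omega> (\<lambda>x. c * \<phi> x + \<phi>' x) w = cnj c * L2_inner \<Omega> \<phi> w + L2_inner \<Omega> \<phi>' w"
    if "w \<in> L2_space \<Omega>" for w
    using that assms by (subst (1 2 3) L2_inner_commute) (simp add: L2_inner_lincomb_right S_L2)
  have grad: "grad_inner \<Omega> (\<lambda>x. c * \<phi> x + \<phi>' x) u = cnj c * grad_inner \<Omega> \<phi> u + grad_inner \<Omega> \<phi>' u"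
    using assms
    by (subst (1 2 3) grad_inner_commute) (simp add: grad_inner_lincomb_right[OF open_domain] S_H1)
  show ?thesis
    unfolding hartree_form_def f_nonlin_eq grad L2[OF potential_L2[OF assms(3)]]
      L2[OF quartic_L2[OF assms(3) assms(3) assms(3)]]
    by (simp only: distrib_left add_ac)
qed

lemma hartree_form_expand_left:
  fixes n :: nat
  assumes e: "e ` {..<n} \<subseteq> S" and u: "u \<in> S"
  shows "hartree_form (\<lambda>x. \<Sum>i<n. c i * e i x) u = (\<Sum>i<n. cnj (c i) * hartree_form (e i) u)"
proof -
  have "cnj (hartree_form (\<lambda>x. \<Sum>i<n. c i * e i x) u) = (\<Sum>i<n. c i * cnj (hartree_form (e i) u))"
    by (rule linear_functional_sum[OF _ e]) (auto simp: hartree_form_lincomb_left u)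
  from arg_cong[OF this, of cnj] show ?thesis by simp
qed

text \<open>In coordinates the right-hand side of the equation is a polynomial in the coordinates and their
  conjugates, which makes it locally Lipschitz.\<close>

lemma hartree_form_polynomial:
  fixes n :: nat
  assumes e: "e ` {..<n} \<subseteq> S" and \<phi>: "\<phi> \<in> S"
  shows "hartree_form \<phi> (\<lambda>x. \<Sum>i<n. c i * e i x) =
    (\<Sum>j<n. c j * grad_inner \<Omega> \<phi> (e j)) + (\<Sum>j<n. c j * L2_inner \<Omega> \<phi> (\<lambda>x. complex_of_real (v x) * e j x))
    + (\<Sum>j<n. c j * (\<Sum>k<n. c k * (\<Sum>l<n. cnj (c l) * quartic \<phi> (e l) (e k) (e j))))"
proof -
  let ?u = "\<lambda>x. \<Sum>i<n. c i * e i x"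
  have u: "?u \<in> S" by (intro S_sum e)
  have grad: "grad_inner \<Omega> \<phi> ?u = (\<Sum>j<n. c j * grad_inner \<Omega> \<phi> (e j))"
    using \<phi> by (intro linear_functional_sum e grad_inner_lincomb_right[OF open_domain] S_H1)
  have pot: "L2_inner \<Omega> \<phi> (\<lambda>x. complex_of_real (v x) * ?u x)
      = (\<Sum>j<n. c j * L2_inner \<Omega> \<phi> (\<lambda>x. complex_of_real (v x) * e j x))"
  proof (rule linear_functional_sum[OF _ e, where l = "\<lambda>u. L2_inner \<Omega> \<phi> (\<lambda>x. complex_of_real (v x) * u x)"])
    fix c u w assume "u \<in> S" "w \<in> S"
    moreover have "(\<lambda>x. complex_of_real (v x) * (c * u x + w x)) =
        (\<lambda>x. c * (complex_of_real (v x) * u x) + complex_of_real (v x) * w x)"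
      by (simp add: fun_eq_iff algebra_simps)
    ultimately show "L2_inner \<Omega> \<phi> (\<lambda>x. complex_of_real (v x) * (c * u x + w x)) =
        c * L2_inner \<Omega> \<phi> (\<lambda>x. complex_of_real (v x) * u x) + L2_inner \<Omega> \<phi> (\<lambda>x. complex_of_real (v x) * w x)"
      using L2_inner_lincomb_right[OF S_L2[OF \<phi>] potential_L2 potential_L2] by simp
  qed
  have "quartic \<phi> ?u ?u ?u = (\<Sum>j<n. c j * quartic \<phi> ?u ?u (e j))"
    by (intro linear_functional_sum e quartic_lincomb \<phi> u)
  also have "\<dots> = (\<Sum>j<n. c j * (\<Sum>k<n. c k * quartic \<phi> ?u (e k) (e j)))"
  proof (intro sum.cong refl arg_cong2[where f = "(*)"])
    fix j assume "j \<in> {..<n}"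
    then have "e j \<in> S" using e by auto
    then show "quartic \<phi> ?u ?u (e j) = (\<Sum>k<n. c k * quartic \<phi> ?u (e k) (e j))"
      by (intro linear_functional_sum[where l = "\<lambda>q. quartic \<phi> ?u q (e j)"] quartic_lincomb \<phi> u e)
  qed
  also have "\<dots> = (\<Sum>j<n. c j * (\<Sum>k<n. c k * (\<Sum>l<n. cnj (c l) * quartic \<phi> (e l) (e k) (e j))))"
  proof (intro sum.cong refl arg_cong2[where f = "(*)"])
    fix j k assume "j \<in> {..<n}" "k \<in> {..<n}"
    then have "e j \<in> S" "e k \<in> S" using e by auto
    then have "cnj (quartic \<phi> ?u (e k) (e j)) = (\<Sum>l<n. c l * cnj (quartic \<phi> (e l) (e k) (e j)))"
      by (intro linear_functional_sum[where l = "\<lambda>p. cnj (quartic \<phi> p (e k) (e j))"] e) (auto simp: quartic_lincomb \<phi>)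
    from arg_cong[OF this, of cnj]
    show "quartic \<phi> ?u (e k) (e j) = (\<Sum>l<n. cnj (c l) * quartic \<phi> (e l) (e k) (e j))" by simp
  qed
  finally show ?thesis
    unfolding hartree_form_def f_nonlin_eq grad pot quartic_def[symmetric] by simp
qed

lemma locally_lipschitz_hartree_form:
  fixes n :: nat
  assumes e: "e ` {..<n} \<subseteq> S" and \<phi>: "\<phi> \<in> S"
  shows "locally_lipschitz n (\<lambda>c. hartree_form \<phi> (\<lambda>x. \<Sum>i<n. c i * e i x))"
  unfolding hartree_form_polynomial[OF e \<phi>]
  by (intro locally_lipschitz_add locally_lipschitz_sum locally_lipschitz_mult locally_lipschitz_coord
      locally_lipschitz_cnj locally_lipschitz_const) auto

text \<open>The gradient term is a Hermitian form on the diagonal, and the two potentials \<open>v\<close> and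
  \<open>lam * interaction u u\<close> are real valued. This is the source of the conservation of mass.\<close>

lemma hartree_form_diagonal_real: "Im (hartree_form u u) = 0"
proof -
  have real: "Im (L2_inner \<Omega> u (\<lambda>x. complex_of_real (r x) * u x)) = 0" for r
  proof -
    have "L2_inner \<Omega> u (\<lambda>x. complex_of_real (r x) * u x) = cnj (L2_inner \<Omega> u (\<lambda>x. complex_of_real (r x) * u x))"
      by (subst (2) L2_inner_commute) (simp add: L2_inner_def mult_ac)
    then show ?thesis by (metis cnj.simps(2) equal_neg_zero)
  qed
  have "interaction u u x = complex_of_real (Re (interaction u u x))" for x
    using interaction_commute[of u u x] by (simp add: complex_eq_iff)
  then have "f_nonlin \<Omega> lam V u = (\<lambda>x. complex_of_real (lam x * Re (interaction u u x)) * u x)"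
    unfolding f_nonlin_eq of_real_mult by presburger
  moreover have "Im (grad_inner \<Omega> u u) = 0"
    using grad_inner_commute[of \<Omega> u u] by (metis cnj.simps(2) equal_neg_zero)
  ultimately show ?thesis
    unfolding hartree_form_def
    using real[of v] real[of "\<lambda>x. lam x * Re (interaction u u x)"] by simp
qed

end

section \<open>Regularity in time\<close>

context galerkin_space
begin

lemma L2_norm_sum_orthonormal:
  assumes basis: "orthonormal_basis n e"
  shows "(L2_norm \<Omega> (\<lambda>x. \<Sum>i<n. c i * e i x))\<^sup>2 = (\<Sum>i<n. (cmod (c i))\<^sup>2)"
proof -
  note e = orthonormal_basisD(1)[OF basis] and on = orthonormal_basisD(3)[OF basis]
  let ?u = "\<lambda>x. \<Sum>i<n. c i * e i x"
  have coord: "L2_inner \<Omega> (e j) ?u = c j" if j: "j < n" for j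
  proof -
    have ej: "e j \<in> S" using e j by auto
    show ?thesis
      unfolding L2_inner_sum_right[OF S_L2[OF ej] e]
      using j by (simp add: on if_distrib[of "\<lambda>w. _ * w"] cong: if_cong)
  qed
  have "complex_of_real ((L2_norm \<Omega> ?u)\<^sup>2) = L2_inner \<Omega> ?u ?u"
    by (rule L2_inner_self[symmetric])
  also have "\<dots> = (\<Sum>i<n. c i * L2_inner \<Omega> ?u (e i))"
    by (intro L2_inner_sum_right S_L2 S_sum e)
  also have "\<dots> = (\<Sum>i<n. c i * cnj (c i))"
  proof (intro sum.cong refl arg_cong2[where f = "(*)"])
    fix i assume "i \<in> {..<n}"
    then show "L2_inner \<Omega> ?u (e i) = cnj (c i)"
      using coord[of i] L2_inner_commute[of \<Omega> ?u "e i"] by simp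
  qed
  also have "\<dots> = complex_of_real (\<Sum>i<n. (cmod (c i))\<^sup>2)"
    by (simp add: complex_norm_square del: of_real_power)
  finally show ?thesis by (simp only: of_real_eq_iff)
qed

text \<open>The simple functions that approximate \<open>u\<close> sample it at the nearest multiple of \<open>1 / (k + 1)\<close> to the
  left. On the bounded interval there are finitely many sample points, all nonnegative, and
  continuity of the coordinates gives convergence at every time.\<close>

lemma continuous_coordinates_Bochner_L2:
  assumes basis: "orthonormal_basis n e"
    and c: "\<And>i. i < n \<Longrightarrow> continuous_on {0..} (\<lambda>t. c t i)"
    and u: "\<And>t. 0 \<le> t \<Longrightarrow> u t = (\<lambda>x. \<Sum>i<n. c t i * e i x)"
  shows "u \<in> Bochner_L2 \<Omega> T S"
proof -
  note e = orthonormal_basisD(1)[OF basis]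
  let ?M = "lebesgue_on {0<..<T}"
  have uS: "u t \<in> S" if "0 \<le> t" for t unfolding u[OF that] by (intro S_sum e)
  define r where "r k t = real_of_int \<lfloor>real (Suc k) * t\<rfloor> / real (Suc k)" for k and t :: real
  have r_nonneg: "0 \<le> r k t" if "0 \<le> t" for k t
    using that unfolding r_def by (intro divide_nonneg_pos) auto
  have simple: "simple_function ?M (\<lambda>t. u (r k t))" for k
  proof (rule simple_function_compose1[where g = u])
    show "simple_function ?M (r k)"
    proof (rule simple_function_borel_measurable)
      show "r k \<in> borel_measurable ?M"
        unfolding r_def by (intro measurable_restrict_space1 measurable_completion) measurable
      have "r k ` space ?M \<subseteq> (\<lambda>i. real_of_int i / real (Suc k)) ` {0..\<lfloor>real (Suc k) * T\<rfloor>}"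
      proof
        fix y assume "y \<in> r k ` space ?M"
        then obtain t where t: "0 < t" "t < T" "y = r k t" by auto
        have "\<lfloor>real (Suc k) * t\<rfloor> \<in> {0..\<lfloor>real (Suc k) * T\<rfloor>}"
          using t by (auto intro!: floor_mono mult_left_mono simp del: of_nat_Suc)
        then show "y \<in> (\<lambda>i. real_of_int i / real (Suc k)) ` {0..\<lfloor>real (Suc k) * T\<rfloor>}"
          unfolding t(3) r_def by (rule imageI)
      qed
      then show "finite (r k ` space ?M)" by (rule finite_subset) simp
    qed
  qed
  have r_tendsto: "(\<lambda>k. r k t) \<longlonglongrightarrow> t" for t
  proof (rule tendsto_sandwich)
    have "t - inverse (real (Suc k)) \<le> r k t" "r k t \<le> t" for k
    proof -
      have "real (Suc k) * t - 1 \<le> real_of_int \<lfloor>real (Suc k) * t\<rfloor>" by linarith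
      then have "(real (Suc k) * t - 1) / real (Suc k) \<le> r k t"
        unfolding r_def by (rule divide_right_mono) simp
      then show "t - inverse (real (Suc k)) \<le> r k t"
        by (simp add: diff_divide_distrib inverse_eq_divide del: of_nat_Suc)
      have "real_of_int \<lfloor>real (Suc k) * t\<rfloor> / real (Suc k) \<le> (real (Suc k) * t) / real (Suc k)"
        by (intro divide_right_mono of_int_floor_le) simp
      then show "r k t \<le> t" unfolding r_def by (simp del: of_nat_Suc)
    qed
    then show "\<forall>\<^sub>F k in sequentially. t - inverse (real (Suc k)) \<le> r k t"
      "\<forall>\<^sub>F k in sequentially. r k t \<le> t" by auto
    show "(\<lambda>k. t - inverse (real (Suc k))) \<longlonglongrightarrow> t"
      using tendsto_diff[OF tendsto_const[of t] LIMSEQ_inverse_real_of_nat] by simp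
  qed simp
  have conv: "(\<lambda>k. L2_norm \<Omega> (\<lambda>x. u (r k t) x - u t x)) \<longlonglongrightarrow> 0" if t: "0 < t" for t
  proof -
    have eq: "(L2_norm \<Omega> (\<lambda>x. u (r k t) x - u t x))\<^sup>2 = (\<Sum>i<n. (cmod (c (r k t) i - c t i))\<^sup>2)" for k
    proof -
      have "(\<lambda>x. u (r k t) x - u t x) = (\<lambda>x. \<Sum>i<n. (c (r k t) i - c t i) * e i x)"
        using u[of "r k t"] u[of t] r_nonneg[of t k] t by (simp add: left_diff_distrib sum_subtractf)
      then show ?thesis using L2_norm_sum_orthonormal[OF basis] by simp
    qed
    have "(\<lambda>k. c (r k t) i) \<longlonglongrightarrow> c t i" if "i < n" for i
      using t r_nonneg[of t] by (intro continuous_on_tendsto_compose[OF c[OF that] r_tendsto]) auto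
    then have "(\<lambda>k. \<Sum>i<n. (cmod (c (r k t) i - c t i))\<^sup>2) \<longlonglongrightarrow> (\<Sum>i<n. (cmod (c t i - c t i))\<^sup>2)"
      by (intro tendsto_intros) auto
    then have "(\<lambda>k. sqrt ((L2_norm \<Omega> (\<lambda>x. u (r k t) x - u t x))\<^sup>2)) \<longlonglongrightarrow> sqrt 0"
      unfolding eq by (intro tendsto_real_sqrt) simp
    then show ?thesis
      by (simp add: tendsto_rabs_zero_iff)
  qed
  have "set_integrable lebesgue {0..T} (\<lambda>t. \<Sum>i<n. (cmod (c t i))\<^sup>2)"
  proof -
    have "continuous_on {0..T} (\<lambda>t. \<Sum>i<n. (cmod (c t i))\<^sup>2)"
      by (intro continuous_intros continuous_on_subset[OF c]) auto
    then show ?thesis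
      by (intro absolutely_integrable_continuous_real)
  qed
  then have "set_integrable lebesgue {0<..<T} (\<lambda>t. \<Sum>i<n. (cmod (c t i))\<^sup>2)"
    by (rule set_integrable_subset) auto
  also have "?this \<longleftrightarrow> set_integrable lebesgue {0<..<T} (\<lambda>t. (L2_norm \<Omega> (u t))\<^sup>2)"
    using L2_norm_sum_orthonormal[OF basis] by (intro set_integrable_cong) (auto simp: u)
  finally have int: "set_integrable lebesgue {0<..<T} (\<lambda>t. (L2_norm \<Omega> (u t))\<^sup>2)" .
  show ?thesis
    unfolding Bochner_L2_def
  proof (intro CollectI conjI exI[of _ "\<lambda>k t. u (r k t)"] allI ballI)
    show "AE t in ?M. u t \<in> S" by (intro AE_I2) (auto intro: uS)
    show "simple_function ?M (\<lambda>t. u (r k t))" for k by (rule simple)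
    show "u (r k t) \<in> S" if "t \<in> {0<..<T}" for k t using that by (intro uS r_nonneg) auto
    show "AE t in ?M. (\<lambda>k. L2_norm \<Omega> (\<lambda>x. u (r k t) x - u t x)) \<longlonglongrightarrow> 0"
      by (intro AE_I2 conv) auto
  qed (rule int)
qed

end

text \<open>Integration by parts: the product with a test function vanishes at both ends of the interval.\<close>

lemma classical_derivative_is_weak_partial:
  fixes a b :: "real \<Rightarrow> complex"
  assumes a: "\<And>t. 0 \<le> t \<Longrightarrow> (a has_vector_derivative b t) (at t within {0..})"
    and b: "continuous_on {0..} b"
  shows "is_weak_partial {0<..<T} 1 a b"
proof -
  have cont_a: "continuous_on {0..} a"
    using a has_vector_derivative_continuous by (fastforce simp: continuous_on_eq_continuous_within)
  have loc: "locally_integrable {0<..<T} f" if f: "continuous_on {0..} f" for f :: "real \<Rightarrow> complex"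
    unfolding locally_integrable_def
  proof (intro allI impI)
    fix K assume K: "compact K \<and> K \<subseteq> {0<..<T}"
    have "continuous_on {0..T} f" using f by (rule continuous_on_subset) auto
    then have "set_integrable lebesgue {0..T} f" by (rule absolutely_integrable_continuous_real)
    moreover have "K \<in> sets borel" using K by (intro borel_closed compact_imp_closed) blast
    then have "K \<in> sets lebesgue" by simp
    moreover have "K \<subseteq> {0..T}" using K by auto
    ultimately show "set_integrable lebesgue K f" by (rule set_integrable_subset)
  qed
  show ?thesis
    unfolding is_weak_partial_def
  proof (intro conjI ballI loc cont_a b)
    fix \<eta> :: "real \<Rightarrow> complex" assume \<eta>: "\<eta> \<in> C0_infinity {0<..<T}"
    obtain K where K: "compact K" "K \<subseteq> {0<..<T}" "\<And>t. t \<notin> K \<Longrightarrow> \<eta> t = 0" "\<And>t. t \<notin> K \<Longrightarrow> partial_deriv 1 \<eta> t = 0"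
      using C0_infinityD(4)[OF \<eta>] by blast
    have \<eta>': "(\<eta> has_vector_derivative partial_deriv 1 \<eta> t) (at t)" for t
    proof -
      have *: "(\<eta> has_derivative frechet_derivative \<eta> (at t)) (at t)"
        using C0_infinityD(3)[OF \<eta>] by (simp flip: frechet_derivative_works)
      then interpret bounded_linear "frechet_derivative \<eta> (at t)" by (rule has_derivative_bounded_linear)
      have "frechet_derivative \<eta> (at t) = (\<lambda>h. h *\<^sub>R partial_deriv 1 \<eta> t)"
      proof
        fix h :: real
        show "frechet_derivative \<eta> (at t) h = h *\<^sub>R partial_deriv 1 \<eta> t"
          using scaleR[of h 1] by (simp add: partial_deriv_def)
      qed
      then show ?thesis using * by (simp add: has_vector_derivative_def)
    qed
    have int: "set_integrable lebesgue {0<..<T} (\<lambda>t. a t * partial_deriv 1 \<eta> t)"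
      "set_integrable lebesgue {0<..<T} (\<lambda>t. b t * \<eta> t)"
      using set_integrable_times_compactly_supported[OF loc[OF cont_a] C0_infinityD(2)[OF \<eta>, of 1] K(1,2,4)]
        set_integrable_times_compactly_supported[OF loc[OF b] C0_infinityD(1)[OF \<eta>] K(1,2,3)] by auto
    have "set_lebesgue_integral lebesgue {0<..<T} (\<lambda>t. a t * partial_deriv 1 \<eta> t + b t * \<eta> t) = 0"
    proof (cases "0 < T")
      case True
      have "((\<lambda>t. a t * partial_deriv 1 \<eta> t + b t * \<eta> t) has_integral (a T * \<eta> T - a 0 * \<eta> 0)) {0..T}"
      proof (rule fundamental_theorem_of_calculus)
        fix t assume "t \<in> {0..T}"
        then show "((\<lambda>t. a t * \<eta> t) has_vector_derivative a t * partial_deriv 1 \<eta> t + b t * \<eta> t) (at t within {0..T})"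
          by (intro has_vector_derivative_mult has_vector_derivative_at_within[OF \<eta>']
              has_vector_derivative_within_subset[OF a]) auto
      qed (use True in simp)
      moreover have "\<eta> T = 0" "\<eta> 0 = 0" using K(2) by (auto intro!: K(3))
      ultimately have "((\<lambda>t. a t * partial_deriv 1 \<eta> t + b t * \<eta> t) has_integral 0) {0<..<T}"
        by (simp add: has_integral_Icc_iff_Ioo)
      then show ?thesis
        using set_lebesgue_integral_eq_integral(2)[OF set_integral_add(1)[OF int]] by (simp add: integral_unique)
    qed (simp add: set_lebesgue_integral_def)
    then show "set_lebesgue_integral lebesgue {0<..<T} (\<lambda>t. a t * partial_deriv 1 \<eta> t)
        = - set_lebesgue_integral lebesgue {0<..<T} (\<lambda>t. b t * \<eta> t)"
      using set_integral_add(2)[OF int] by (simp add: add_eq_0_iff2)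
  qed
qed

section \<open>Global semidiscrete solutions\<close>

context hartree_galerkin
begin

abbreviation global_solution :: "('a \<Rightarrow> complex) \<Rightarrow> (real \<Rightarrow> 'a \<Rightarrow> complex) \<Rightarrow> bool" where
  "global_solution \<psi>0 \<psi> \<equiv> \<psi> \<in> {0..} \<rightarrow>\<^sub>E S \<and> (\<forall>T>0. semidiscrete_solution \<Omega> v lam V S \<psi>0 T \<psi>)"

text \<open>Antilinearity in the first argument contracts the sum to the diagonal value of the form.\<close>

lemma hartree_coordinates_conservative:
  fixes n :: nat
  assumes e: "e ` {..<n} \<subseteq> S"
  shows "Im (\<Sum>i<n. cnj (c i) * hartree_form (e i) (\<lambda>x. \<Sum>j<n. c j * e j x)) = 0"
  using hartree_form_expand_left[OF e S_sum[OF e], of c c]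
    hartree_form_diagonal_real[of "\<lambda>x. \<Sum>i<n. c i * e i x"] by simp

text \<open>The coordinates with respect to an orthonormal basis solve a conservative system. Its solution
  is differentiable on all of \<open>[0,\<infinity>)\<close> with continuous derivative, which yields the Bochner and the
  weak time derivative conditions, and expanding \<open>\<phi>\<close> in the basis recovers the equation for all test
  functions.\<close>

lemma global_solution_exists:
  assumes \<psi>0: "\<psi>0 \<in> S"
  shows "\<exists>\<psi>. global_solution \<psi>0 \<psi>"
proof -
  obtain n e where basis: "orthonormal_basis n e"
    using orthonormal_basis_exists by blast
  note e = orthonormal_basisD(1)[OF basis] and eS = orthonormal_basisD(2)[OF basis]
    and expand = orthonormal_basisD(4)[OF basis]
  define u where "u c = (\<lambda>x. \<Sum>i<n. c i * e i x)" for c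
  have uS: "u c \<in> S" for c unfolding u_def by (intro S_sum e)
  define F where "F i c = hartree_form (e i) (u c)" for i c
  have "\<exists>c. (\<forall>i<n. c 0 i = L2_inner \<Omega> (e i) \<psi>0) \<and>
    (\<forall>t\<ge>0. \<forall>i<n. ((\<lambda>\<tau>. c \<tau> i) has_vector_derivative - \<i> * F i (c t)) (at t within {0..}))"
  proof (rule conservative_system_global_solution)
    show "locally_lipschitz n (F i)" if "i < n" for i
      unfolding F_def[abs_def] u_def by (rule locally_lipschitz_hartree_form[OF e eS[OF that]])
    show "Im (\<Sum>i<n. cnj (c i) * F i c) = 0" for c
      unfolding F_def u_def by (rule hartree_coordinates_conservative[OF e])
  qed
  then obtain c where c0: "\<And>i. i < n \<Longrightarrow> c 0 i = L2_inner \<Omega> (e i) \<psi>0"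
    and c: "\<And>t i. 0 \<le> t \<Longrightarrow> i < n \<Longrightarrow>
      ((\<lambda>\<tau>. c \<tau> i) has_vector_derivative - \<i> * F i (c t)) (at t within {0..})"
    by blast
  define \<psi> where "\<psi> t = (if 0 \<le> t then u (c t) else undefined)" for t
  define w where "w t = u (\<lambda>i. - \<i> * F i (c t))" for t
  have \<psi>_ext: "\<psi> \<in> {0..} \<rightarrow>\<^sub>E S" by (auto simp: \<psi>_def uS)
  have \<psi>_0: "\<psi> 0 = \<psi>0"
    using expand[OF \<psi>0] by (simp add: \<psi>_def u_def c0)
  have cont_c: "continuous_on {0..} (\<lambda>t. c t i)" if "i < n" for i
    using c[OF _ that] has_vector_derivative_continuous by (fastforce simp: continuous_on_eq_continuous_within)
  have cont_F: "continuous_on {0..} (\<lambda>t. - \<i> * F i (c t))" if "i < n" for i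
    unfolding F_def u_def hartree_form_polynomial[OF e eS[OF that]]
    by (intro continuous_intros cont_c) auto
  have inner_u: "L2_inner \<Omega> \<phi> (u d) = (\<Sum>i<n. d i * L2_inner \<Omega> \<phi> (e i))" if "\<phi> \<in> S" for \<phi> d
    unfolding u_def by (rule L2_inner_sum_right[OF S_L2[OF that] e])
  have deriv: "((\<lambda>\<tau>. L2_inner \<Omega> \<phi> (\<psi> \<tau>)) has_vector_derivative L2_inner \<Omega> \<phi> (w t)) (at t within {0..})"
    if \<phi>: "\<phi> \<in> S" and t: "0 \<le> t" for \<phi> t
  proof (rule has_vector_derivative_transform)
    show "((\<lambda>\<tau>. \<Sum>i<n. c \<tau> i * L2_inner \<Omega> \<phi> (e i)) has_vector_derivative L2_inner \<Omega> \<phi> (w t)) (at t within {0..})"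
      unfolding w_def inner_u[OF \<phi>]
      by (intro has_vector_derivative_sum has_vector_derivative_mult_left c t) auto
  qed (use t in \<open>auto simp: \<psi>_def inner_u[OF \<phi>]\<close>)
  have form: "\<i> * L2_inner \<Omega> \<phi> (w t) = hartree_form \<phi> (\<psi> t)" if \<phi>: "\<phi> \<in> S" and t: "0 \<le> t" for \<phi> t
  proof -
    have "hartree_form \<phi> (u (c t)) = (\<Sum>i<n. cnj (L2_inner \<Omega> (e i) \<phi>) * F i (c t))"
      by (subst expand[OF \<phi>]) (simp add: hartree_form_expand_left[OF e uS] F_def)
    also have "\<dots> = (\<Sum>i<n. L2_inner \<Omega> \<phi> (e i) * F i (c t))"
      by (simp flip: L2_inner_commute)
    also have "\<dots> = \<i> * L2_inner \<Omega> \<phi> (w t)"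
      by (simp add: w_def inner_u[OF \<phi>] sum_distrib_left mult_ac sum_negf)
    finally show ?thesis using t by (simp add: \<psi>_def)
  qed
  have "semidiscrete_solution \<Omega> v lam V S \<psi>0 T \<psi>" for T
    unfolding semidiscrete_solution_def
  proof (intro conjI ballI)
    show "\<psi> t \<in> S" if "t \<in> {0..<T}" for t using that by (simp add: \<psi>_def uS)
    show "\<psi> \<in> Bochner_L2 \<Omega> T S"
      by (rule continuous_coordinates_Bochner_L2[OF basis cont_c]) (auto simp: \<psi>_def u_def)
    show "\<exists>w\<in>Bochner_L2 \<Omega> T S. is_weak_time_deriv \<Omega> T S \<psi> w"
    proof (rule bexI)
      show "w \<in> Bochner_L2 \<Omega> T S"
        by (rule continuous_coordinates_Bochner_L2[OF basis cont_F]) (auto simp: w_def u_def)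
      show "is_weak_time_deriv \<Omega> T S \<psi> w"
        unfolding is_weak_time_deriv_def
      proof (intro ballI classical_derivative_is_weak_partial deriv)
        fix \<phi> assume \<phi>: "\<phi> \<in> S"
        show "continuous_on {0..} (\<lambda>t. L2_inner \<Omega> \<phi> (w t))"
          unfolding w_def inner_u[OF \<phi>] by (intro continuous_on_sum continuous_on_mult continuous_on_const cont_F) auto
      qed
    qed
    show "\<psi> 0 = \<psi>0" by (rule \<psi>_0)
    fix \<phi> t assume \<phi>: "\<phi> \<in> S" and t: "t \<in> {0..<T}"
    have "((\<lambda>\<tau>. L2_inner \<Omega> \<phi> (\<psi> \<tau>)) has_vector_derivative L2_inner \<Omega> \<phi> (w t)) (at t within {0..<T})"
      by (rule has_vector_derivative_within_subset[OF deriv]) (use \<phi> t in auto)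
    then show "\<exists>D. ((\<lambda>\<tau>. L2_inner \<Omega> \<phi> (\<psi> \<tau>)) has_vector_derivative D) (at t within {0..<T}) \<and>
        \<i> * D = grad_inner \<Omega> \<phi> (\<psi> t) + L2_inner \<Omega> \<phi> (\<lambda>x. complex_of_real (v x) * \<psi> t x)
          + L2_inner \<Omega> \<phi> (f_nonlin \<Omega> lam V (\<psi> t))"
      using form[OF \<phi>, of t] t unfolding hartree_form_def by auto
  qed
  with \<psi>_ext show ?thesis by blast
qed

text \<open>The equation on \<open>[0,T)\<close> for a \<open>T > t\<close> determines the derivative at \<open>t\<close> relative to \<open>[0,\<infinity>)\<close>.\<close>

lemma global_solution_derivative:
  assumes \<psi>: "global_solution \<psi>0 \<psi>" and \<phi>: "\<phi> \<in> S" and t: "0 \<le> t"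
  shows "((\<lambda>\<tau>. L2_inner \<Omega> \<phi> (\<psi> \<tau>)) has_vector_derivative - \<i> * hartree_form \<phi> (\<psi> t)) (at t within {0..})"
proof -
  have "semidiscrete_solution \<Omega> v lam V S \<psi>0 (t + 1) \<psi>" using \<psi> t by auto
  then obtain D where D: "((\<lambda>\<tau>. L2_inner \<Omega> \<phi> (\<psi> \<tau>)) has_vector_derivative D) (at t within {0..<t + 1})"
    "\<i> * D = hartree_form \<phi> (\<psi> t)"
    using \<phi> t unfolding semidiscrete_solution_def hartree_form_def by (meson atLeastLessThan_iff less_add_one)
  have "D = - \<i> * hartree_form \<phi> (\<psi> t)"
    unfolding D(2)[symmetric] by (simp flip: mult.assoc)
  moreover have "at t within {0..<t + 1} = at t within {0..}"
    by (rule at_within_nhd[of _ "{t-1<..<t+1}"]) (use t in auto)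
  ultimately show ?thesis using D(1) by simp
qed

text \<open>The pointwise equation tested with the basis vectors shows that the coordinates of any solution
  solve the conservative system, and they determine the solution.\<close>

lemma global_solution_unique:
  assumes \<psi>: "global_solution \<psi>0 \<psi>" and \<psi>': "global_solution \<psi>0 \<psi>'"
  shows "\<psi> = \<psi>'"
proof -
  obtain n e where basis: "orthonormal_basis n e"
    using orthonormal_basis_exists by blast
  note e = orthonormal_basisD(1)[OF basis] and eS = orthonormal_basisD(2)[OF basis]
    and expand = orthonormal_basisD(4)[OF basis]
  define F where "F i c = hartree_form (e i) (\<lambda>x. \<Sum>j<n. c j * e j x)" for i c
  have deriv: "((\<lambda>\<tau>. L2_inner \<Omega> (e i) (\<xi> \<tau>)) has_vector_derivative - \<i> * F i (\<lambda>j. L2_inner \<Omega> (e j) (\<xi> t))) (at t within {0..})"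
    if \<xi>: "global_solution \<psi>0 \<xi>" and i: "i < n" and t: "0 \<le> t" for \<xi> i t
  proof -
    have "\<xi> t \<in> S" using \<xi> t by (auto dest: PiE_mem)
    then have "F i (\<lambda>j. L2_inner \<Omega> (e j) (\<xi> t)) = hartree_form (e i) (\<xi> t)"
      unfolding F_def using expand by metis
    then show ?thesis using global_solution_derivative[OF \<xi> eS[OF i] t] by simp
  qed
  have init: "\<xi> 0 = \<psi>0" if "global_solution \<psi>0 \<xi>" for \<xi>
    using that by (auto simp: semidiscrete_solution_def dest: spec[of _ 1])
  have coord: "L2_inner \<Omega> (e i) (\<psi> t) = L2_inner \<Omega> (e i) (\<psi>' t)" if "0 \<le> t" "i < n" for t i
  proof (rule conservative_system_unique[where c = "\<lambda>t i. L2_inner \<Omega> (e i) (\<psi> t)" and d = "\<lambda>t i. L2_inner \<Omega> (e i) (\<psi>' t)" and F = F])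
    show "locally_lipschitz n (F i)" if "i < n" for i
      unfolding F_def[abs_def] by (rule locally_lipschitz_hartree_form[OF e eS[OF that]])
    show "Im (\<Sum>i<n. cnj (c i) * F i c) = 0" for c
      unfolding F_def by (rule hartree_coordinates_conservative[OF e])
  qed (use deriv[OF \<psi>] deriv[OF \<psi>'] init[OF \<psi>] init[OF \<psi>'] that in auto)
  show "\<psi> = \<psi>'"
  proof (rule PiE_ext[of _ "{0..}" "\<lambda>_. S"])
    fix t :: real assume "t \<in> {0..}"
    moreover from this have "\<psi> t \<in> S" "\<psi>' t \<in> S" using \<psi> \<psi>' by (auto dest: PiE_mem)
    ultimately show "\<psi> t = \<psi>' t"
      using expand[of "\<psi> t"] expand[of "\<psi>' t"] coord[of t] by simp
  qed (use \<psi> \<psi>' in auto)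
qed

end

theorem theorem21:
  fixes \<Omega> :: "(real ^ 'n) set"
    and v lam V :: "real ^ 'n \<Rightarrow> real"
    and S :: "real \<Rightarrow> (real ^ 'n \<Rightarrow> complex) set"
    and N :: "real \<Rightarrow> nat"
    and h :: real
    and \<psi>0 :: "real ^ 'n \<Rightarrow> complex"
  assumes "bounded_smooth_domain \<Omega>"
    and "v \<in> C0_infinity \<Omega>"
    and "lam \<in> C0_infinity \<Omega>"
    and "V \<in> C0_infinity UNIV"
    and "galerkin_family \<Omega> S N"
    and "\<forall>x. V (- x) = V x"
    and "h \<in> {0<..<1}"
    and "\<psi>0 \<in> S h"
  shows "\<exists>!\<psi>. \<psi> \<in> {0..} \<rightarrow>\<^sub>E S h \<and>
           (\<forall>T>0. semidiscrete_solution \<Omega> v lam V (S h) \<psi>0 T \<psi>)"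
proof -
  interpret hartree_galerkin \<Omega> "S h" v lam V
    using assms(1-5,7)
    by unfold_locales (auto simp: bounded_smooth_domain_def galerkin_family_def)
  show ?thesis
    using global_solution_exists[OF assms(8)] global_solution_unique by blast
qed

end
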